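(* Let $X_1,X_2,U$ be Hilbert spaces, and let $(G_1,L_1,K_1)$ and $(G_2,L_2,K_2)$ be impedance passive boundary nodes on $(U,X_1,U)$ and $(U,X_2,U)$, respectively. Let $A_0$ denote the restriction of $L_1$ to $\operatorname{Ker}(G_1+K_1)$, let $A_2$ denote the restriction of $L_2$ to $\operatorname{Ker}G_2$, and let $P_2\colon\rho(A_2)\to\mathcal{B}(U)$ be the transfer function of $(G_2,L_2,K_2)$ given by $P_2(\lambda)u=K_2x$, where $x\in D(L_2)$ is the unique solution of $(\lambda-L_2)x=0$, $G_2x=u$. Suppose that $i\mathbb{R}\subseteq\rho(A_0)\cap\rho(A_2)$ and let $M_0\colon\mathbb{R}\to[r,\infty)$, for some $r>0$, be such that $$\|(is-A_0)^{-1}\|\le M_0(s),\qquad s\in\mathbb{R}.$$ Suppose further that there exists a function $\eta\colon\mathbb{R}\to(0,\infty)$ such that $$\operatorname{Re}\langle P_2(is)u,u\rangle_U\ge\eta(s)\|u\|^2,\qquad u\in U,\ s\in\mathbb{R},$$ and that $\|(is-A_2)^{-1}\|$ and $\|P_2(1+is)\|$ are uniformly bounded with respect to $s\in\mathbb{R}$. Consider the coupled system $$\dot z_1(t)=L_1z_1(t),\quad \dot z_2(t)=L_2z_2(t),\quad G_1z_1(t)=K_2z_2(t),\quad G_2z_2(t)=-K_1z_1(t),\qquad t\ge0,$$ with $z_1(0)\in X_1$, $z_2(0)\in X_2$. This system can be reformulated as the abstract Cauchy problem $\dot z(t)=Az(t)$, $t\ge 0$, on the Hilbert space $X=X_1\times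 X_2$ for $z=(z_1,z_2)^\top$, where the system operator is $A=\operatorname{diag}(L_1,L_2)$ with domain $$D(A)=\{(x_1,x_2)^\top\in D(L_1)\times D(L_2): G_1x_1=K_2x_2,\ G_2x_2=-K_1x_1\}.$$ The operator $A$ generates a contraction semigroup on $X$, satisfies $i\mathbb{R}\subseteq\rho(A)$, and there is a constant $C>0$ independent of $s$ such that $$\|(is-A)^{-1}\|\le C\,\frac{M_0(s)}{\eta(s)},\qquad s\in\mathbb{R}.$$
   Context: All spaces are complex; $\mathcal{B}(X,Y)$ denotes the bounded linear operators from $X$ to $Y$, $\mathcal{B}(X)=\mathcal{B}(X,X)$, and $\rho(\cdot)$ is the resolvent set. Domains of linear operators carry the graph norm. Let $X,U$ be Hilbert spaces and let $L\colon D(L)\subseteq X\to X$ and $G,K\colon D(L)\subseteq X\to U$ be linear. The triple $(G,L,K)$ is a boundary node on $(U,X,U)$ if (i) $G,K\in\mathcal{B}(D(L),U)$; (ii) the restriction $A$ of $L$ to $\operatorname{Ker}G$ generates a $C_0$-semigroup on $X$; (iii) there exists $G^r\in\mathcal{B}(U,D(L))$ with $GG^r=I$. It is impedance passive if $\operatorname{Re}\langle Lx,x\rangle_X\le\operatorname{Re}\langle Gx,Kx\rangle_U$ for all $x\in D(L)$; in this case the semigroup generated by the restriction of $L$ to $\operatorname{Ker} G$ is contractive, so its generator has the open right half-plane in its resolvent set.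
   Formalization: The Hilbert space U is assumed nonzero; for U = {0} the condition on P_2 is vacuous for every η and the final estimate fails (e.g. X_1 = X_2 = ℂ, L_1 = L_2 = −1, M_0 = 1, η(s) = 1+s²). *)

theory Defs
  imports "HOL-Analysis.Analysis"
begin

section \<open>Complex Hilbert spaces\<close>

text \<open>
  The complex inner product is linear in its first argument.  Its real part is the library's
  \<open>inner\<close>, so that norm, topology and completeness are the library's; in particular
  \<open>cinner x x = (norm x)\<^sup>2\<close> follows from the axioms.
\<close>

class complex_inner = real_inner +
  fixes scaleC :: "complex \<Rightarrow> 'a \<Rightarrow> 'a" (infixr "*\<^sub>C" 75)
    and cinner :: "'a \<Rightarrow> 'a \<Rightarrow> complex"
  assumes scaleC_add_right: "c *\<^sub>C (x + y) = c *\<^sub>C x + c *\<^sub>C y"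
    and scaleC_add_left: "(c + d) *\<^sub>C x = c *\<^sub>C x + d *\<^sub>C x"
    and scaleC_scaleC: "c *\<^sub>C d *\<^sub>C x = (c * d) *\<^sub>C x"
    and scaleC_of_real: "complex_of_real r *\<^sub>C x = r *\<^sub>R x"
    and cinner_commute: "cinner x y = cnj (cinner y x)"
    and cinner_add_left: "cinner (x + y) z = cinner x z + cinner y z"
    and cinner_scaleC_left: "cinner (c *\<^sub>C x) y = c * cinner x y"
    and Re_cinner: "Re (cinner x y) = inner x y"

class chilbert_space = complex_inner + complete_space

instance chilbert_space \<subseteq> banach ..

lemma cinner_self: "cinner x x = complex_of_real ((norm x)\<^sup>2)"
  for x :: "'a::complex_inner"
proof (rule complex_eqI)
  show "Re (cinner x x) = Re (complex_of_real ((norm x)\<^sup>2))"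
    by (simp add: Re_cinner power2_norm_eq_inner)
  have "Im (cinner x x) = - Im (cinner x x)"
    using cinner_commute[of x x] by (metis cnj.sel(2))
  then show "Im (cinner x x) = Im (complex_of_real ((norm x)\<^sup>2))"
    by simp
qed

text \<open>The product carries the sum of the two inner products.\<close>

instantiation prod :: (complex_inner, complex_inner) complex_inner
begin

definition scaleC_prod :: "complex \<Rightarrow> 'a \<times> 'b \<Rightarrow> 'a \<times> 'b"
  where "scaleC_prod c x = (c *\<^sub>C fst x, c *\<^sub>C snd x)"

definition cinner_prod :: "'a \<times> 'b \<Rightarrow> 'a \<times> 'b \<Rightarrow> complex"
  where "cinner_prod x y = cinner (fst x) (fst y) + cinner (snd x) (snd y)"

instance
proof
  fix x y :: "'a \<times> 'b"
  show "cinner x y = cnj (cinner y x)"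
    unfolding cinner_prod_def complex_cnj_add
    by (simp only: cinner_commute[symmetric])
qed (auto simp: scaleC_prod_def cinner_prod_def inner_prod_def scaleC_add_right scaleC_add_left
       scaleC_scaleC scaleC_of_real scaleR_prod_def cinner_add_left cinner_scaleC_left Re_cinner
       algebra_simps)

end

instance prod :: (chilbert_space, chilbert_space) chilbert_space ..


section \<open>Linear operators, resolvents and semigroups\<close>

text \<open>
  An operator with domain \<open>D\<close> is a pair of the set \<open>D\<close> and a total function, whose values
  outside \<open>D\<close> are irrelevant.
\<close>

definition csubspace :: "'a::complex_inner set \<Rightarrow> bool"
  where "csubspace D \<longleftrightarrow>
    0 \<in> D \<and> (\<forall>x\<in>D. \<forall>y\<in>D. x + y \<in> D) \<and> (\<forall>c. \<forall>x\<in>D. c *\<^sub>C x \<in> D)"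

definition clinear_on :: "'a::complex_inner set \<Rightarrow> ('a \<Rightarrow> 'b::complex_inner) \<Rightarrow> bool"
  where "clinear_on D f \<longleftrightarrow> csubspace D \<and>
    (\<forall>x\<in>D. \<forall>y\<in>D. f (x + y) = f x + f y) \<and> (\<forall>c. \<forall>x\<in>D. f (c *\<^sub>C x) = c *\<^sub>C f x)"

definition bounded_clinear :: "('a::complex_inner \<Rightarrow> 'b::complex_inner) \<Rightarrow> bool"
  where "bounded_clinear f \<longleftrightarrow> bounded_linear f \<and> (\<forall>c x. f (c *\<^sub>C x) = c *\<^sub>C f x)"

text \<open>
  The resolvent set consists of those \<open>\<mu>\<close> for which \<open>\<mu> - A : D \<rightarrow> X\<close> has an everywhere defined
  bounded inverse.
\<close>

definition resolvent :: "'a::complex_inner set \<Rightarrow> ('a \<Rightarrow> 'a) \<Rightarrow> complex \<Rightarrow> 'a \<Rightarrow> 'a"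
  where "resolvent D A \<mu> = inv_into D (\<lambda>x. \<mu> *\<^sub>C x - A x)"

definition resolvent_set :: "'a::complex_inner set \<Rightarrow> ('a \<Rightarrow> 'a) \<Rightarrow> complex set"
  where "resolvent_set D A =
    {\<mu>. bij_betw (\<lambda>x. \<mu> *\<^sub>C x - A x) D UNIV \<and> bounded_clinear (resolvent D A \<mu>)}"

text \<open>Semigroups are indexed by all reals, but only times \<open>t \<ge> 0\<close> matter.\<close>

definition C0_semigroup :: "(real \<Rightarrow> 'a \<Rightarrow> 'a::chilbert_space) \<Rightarrow> bool"
  where "C0_semigroup T \<longleftrightarrow>
    (\<forall>t\<ge>0. bounded_clinear (T t)) \<and> T 0 = id \<and>
    (\<forall>s\<ge>0. \<forall>t\<ge>0. T (s + t) = T s \<circ> T t) \<and>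
    (\<forall>x. ((\<lambda>t. T t x) \<longlongrightarrow> x) (at_right 0))"

definition is_generator ::
    "(real \<Rightarrow> 'a \<Rightarrow> 'a::chilbert_space) \<Rightarrow> 'a set \<Rightarrow> ('a \<Rightarrow> 'a) \<Rightarrow> bool"
  where "is_generator T D A \<longleftrightarrow>
    D = {x. \<exists>y. ((\<lambda>h. (T h x - x) /\<^sub>R h) \<longlongrightarrow> y) (at_right 0)} \<and>
    (\<forall>x\<in>D. ((\<lambda>h. (T h x - x) /\<^sub>R h) \<longlongrightarrow> A x) (at_right 0))"

definition generates_C0_semigroup :: "'a::chilbert_space set \<Rightarrow> ('a \<Rightarrow> 'a) \<Rightarrow> bool"
  where "generates_C0_semigroup D A \<longleftrightarrow> (\<exists>T. C0_semigroup T \<and> is_generator T D A)"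

definition generates_contraction_semigroup :: "'a::chilbert_space set \<Rightarrow> ('a \<Rightarrow> 'a) \<Rightarrow> bool"
  where "generates_contraction_semigroup D A \<longleftrightarrow>
    (\<exists>T. C0_semigroup T \<and> (\<forall>t\<ge>0. onorm (T t) \<le> 1) \<and> is_generator T D A)"


section \<open>Boundary nodes\<close>

definition graph_norm :: "('a::chilbert_space \<Rightarrow> 'a) \<Rightarrow> 'a \<Rightarrow> real"
  where "graph_norm L x = norm (x, L x)"

definition bounded_from_domain ::
    "'x::chilbert_space set \<Rightarrow> ('x \<Rightarrow> 'x) \<Rightarrow> ('x \<Rightarrow> 'u::chilbert_space) \<Rightarrow> bool"
  where "bounded_from_domain D L G \<longleftrightarrow>
    clinear_on D G \<and> (\<exists>C. \<forall>x\<in>D. norm (G x) \<le> C * graph_norm L x)"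

definition bounded_into_domain ::
    "'x::chilbert_space set \<Rightarrow> ('x \<Rightarrow> 'x) \<Rightarrow> ('u::chilbert_space \<Rightarrow> 'x) \<Rightarrow> bool"
  where "bounded_into_domain D L H \<longleftrightarrow>
    clinear_on UNIV H \<and> range H \<subseteq> D \<and> (\<exists>C. \<forall>u. graph_norm L (H u) \<le> C * norm u)"

definition ker_on :: "'x set \<Rightarrow> ('x \<Rightarrow> 'u::zero) \<Rightarrow> 'x set"
  where "ker_on D G = {x \<in> D. G x = 0}"

definition boundary_node ::
    "'x::chilbert_space set \<Rightarrow> ('x \<Rightarrow> 'u::chilbert_space) \<Rightarrow> ('x \<Rightarrow> 'x) \<Rightarrow> ('x \<Rightarrow> 'u) \<Rightarrow> bool"
  where "boundary_node D G L K \<longleftrightarrow>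
    clinear_on D L \<and>
    bounded_from_domain D L G \<and> bounded_from_domain D L K \<and>
    generates_C0_semigroup (ker_on D G) L \<and>
    (\<exists>Gr. bounded_into_domain D L Gr \<and> (\<forall>u. G (Gr u) = u))"

definition impedance_passive ::
    "'x::chilbert_space set \<Rightarrow> ('x \<Rightarrow> 'u::chilbert_space) \<Rightarrow> ('x \<Rightarrow> 'x) \<Rightarrow> ('x \<Rightarrow> 'u) \<Rightarrow> bool"
  where "impedance_passive D G L K \<longleftrightarrow>
    (\<forall>x\<in>D. Re (cinner (L x) x) \<le> Re (cinner (G x) (K x)))"

text \<open>
  The solution \<open>x\<close> is unique, and hence the description is meaningful, for \<open>\<mu>\<close> in the resolvent
  set of the restriction of \<open>L\<close> to \<open>ker_on D G\<close>.
\<close>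

definition transfer_function ::
    "'x::chilbert_space set \<Rightarrow> ('x \<Rightarrow> 'u::chilbert_space) \<Rightarrow> ('x \<Rightarrow> 'x) \<Rightarrow> ('x \<Rightarrow> 'u)
      \<Rightarrow> complex \<Rightarrow> 'u \<Rightarrow> 'u"
  where "transfer_function D G L K \<mu> u = K (THE x. x \<in> D \<and> \<mu> *\<^sub>C x - L x = 0 \<and> G x = u)"


section \<open>The coupled system\<close>

definition solves_cauchy ::
    "'a::chilbert_space set \<Rightarrow> ('a \<Rightarrow> 'a) \<Rightarrow> (real \<Rightarrow> 'a) \<Rightarrow> bool"
  where "solves_cauchy D A z \<longleftrightarrow>
    (\<forall>t\<ge>0. z t \<in> D \<and> (z has_vector_derivative A (z t)) (at t within {0..}))"

definition solves_coupled ::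
    "'x1::chilbert_space set \<Rightarrow> ('x1 \<Rightarrow> 'u::chilbert_space) \<Rightarrow> ('x1 \<Rightarrow> 'x1) \<Rightarrow> ('x1 \<Rightarrow> 'u)
      \<Rightarrow> 'x2::chilbert_space set \<Rightarrow> ('x2 \<Rightarrow> 'u) \<Rightarrow> ('x2 \<Rightarrow> 'x2) \<Rightarrow> ('x2 \<Rightarrow> 'u)
      \<Rightarrow> (real \<Rightarrow> 'x1) \<Rightarrow> (real \<Rightarrow> 'x2) \<Rightarrow> bool"
  where "solves_coupled D1 G1 L1 K1 D2 G2 L2 K2 z1 z2 \<longleftrightarrow>
    (\<forall>t\<ge>0. z1 t \<in> D1 \<and> z2 t \<in> D2 \<and>
      (z1 has_vector_derivative L1 (z1 t)) (at t within {0..}) \<and>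
      (z2 has_vector_derivative L2 (z2 t)) (at t within {0..}) \<and>
      G1 (z1 t) = K2 (z2 t) \<and> G2 (z2 t) = - K1 (z1 t))"

definition coupled_domain ::
    "'x1 set \<Rightarrow> ('x1 \<Rightarrow> 'u::uminus) \<Rightarrow> ('x1 \<Rightarrow> 'u) \<Rightarrow> 'x2 set \<Rightarrow> ('x2 \<Rightarrow> 'u) \<Rightarrow> ('x2 \<Rightarrow> 'u)
      \<Rightarrow> ('x1 \<times> 'x2) set"
  where "coupled_domain D1 G1 K1 D2 G2 K2 =
    {(x1, x2). x1 \<in> D1 \<and> x2 \<in> D2 \<and> G1 x1 = K2 x2 \<and> G2 x2 = - K1 x1}"

definition coupled_operator ::
    "('x1 \<Rightarrow> 'x1) \<Rightarrow> ('x2 \<Rightarrow> 'x2) \<Rightarrow> 'x1 \<times> 'x2 \<Rightarrow> 'x1 \<times> 'x2"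
  where "coupled_operator L1 L2 = (\<lambda>(x1, x2). (L1 x1, L2 x2))"

end

theory Submission
  imports Defs
begin

text \<open>
  Passivity makes \<open>A\<close> dissipative. At a frequency \<open>\<i> s\<close> the equation for \<open>x\<^sub>1\<close> becomes
  \<open>(\<i> s - L\<^sub>1) x\<^sub>1 = y\<^sub>1\<close>, \<open>G\<^sub>1 x\<^sub>1 + P\<^sub>2(\<i> s) K\<^sub>1 x\<^sub>1 = v\<close>, and passivity of the first node together with coercivity
  of \<open>P\<^sub>2(\<i> s)\<close> gives \<open>\<eta> \<parallel>K\<^sub>1 x\<^sub>1\<parallel>\<^sup>2 \<le> \<parallel>v\<parallel> \<parallel>K\<^sub>1 x\<^sub>1\<parallel> + \<parallel>y\<^sub>1\<parallel> \<parallel>x\<^sub>1\<parallel>\<close>. Regarding \<open>x\<^sub>1\<close> as a solution of the boundary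
  problem for \<open>G\<^sub>1 + K\<^sub>1\<close>, one has \<open>\<parallel>x\<^sub>1\<parallel> \<le> M\<^sub>0 \<parallel>y\<^sub>1\<parallel> + \<surd>M\<^sub>0 \<parallel>(G\<^sub>1 + K\<^sub>1) x\<^sub>1\<parallel>\<close>; the square root is what
  turns the two estimates into the rate \<open>M\<^sub>0 / \<eta>\<close> instead of \<open>M\<^sub>0\<^sup>2 / \<eta>\<close>. Solvability at \<open>\<i> s\<close> is a fixed
  point of the feedback loop in the scattering variables \<open>G \<plusminus> K\<close>, and \<open>0 \<in> \<rho>(A)\<close> makes \<open>A\<close>
  m-dissipative, hence a generator.
\<close>

section \<open>Complex scalars and linear maps\<close>

text \<open>In the bound for the norm of \<open>K1 x1\<close>, the norm of \<open>x1\<close> enters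
  only through sqrt(|y1| |x1| / \<eta>). Multiplied by sqrt M0, this is the geometric mean of (M0 /
  \<eta>) |y1| and |x1|, so half of |x1| can be absorbed. The other terms are dominated by M0 /
  \<eta> because M0 is bounded below by \<open>r\<close> and \<eta> is bounded above; the latter
  follows from coercivity itself, tested on a nonzero vector of U. The obstacle at the second node
  is that P2 is uniformly bounded only on Re \<mu> = 1, while the energy estimate takes place on the
  imaginary axis. Bounds for \<open>x2\<close> and \<open>K2 x2\<close> that are uniform in
  \<open>s\<close> are therefore derived separately. Existence and estimate are kept apart: the
  contraction factor of the feedback loop may degenerate with \<open>s\<close>, since the constant
  in the resolvent bound comes only from the a priori estimate.\<close>

lemma scaleC_one [simp]: "1 *\<^sub>C x = x" for x :: "'a::complex_inner"
  using scaleC_of_real[of 1 x] by simp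

lemma scaleC_zero_left [simp]: "0 *\<^sub>C x = 0" for x :: "'a::complex_inner"
  using scaleC_of_real[of 0 x] by simp

lemma scaleC_minus_one [simp]: "(- 1) *\<^sub>C x = - x" for x :: "'a::complex_inner"
  using scaleC_of_real[of "- 1" x] by simp

lemma scaleC_minus_left: "(- c) *\<^sub>C x = - (c *\<^sub>C x)" for x :: "'a::complex_inner"
  using scaleC_scaleC[of "- 1" c x] by simp

lemma scaleC_diff_left: "(c - d) *\<^sub>C x = c *\<^sub>C x - d *\<^sub>C x" for x :: "'a::complex_inner"
  using scaleC_add_left[of c "- d" x] by (simp add: scaleC_minus_left)

lemma scaleC_minus_right: "c *\<^sub>C (- x) = - (c *\<^sub>C x)" for x :: "'a::complex_inner"
  using scaleC_scaleC[of c "- 1" x] scaleC_scaleC[of "- 1" c x] by simp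

lemma scaleC_diff_right: "c *\<^sub>C (x - y) = c *\<^sub>C x - c *\<^sub>C y" for x :: "'a::complex_inner"
  using scaleC_add_right[of c x "- y"] by (simp add: scaleC_minus_right)

lemma scaleC_scaleR: "c *\<^sub>C (r *\<^sub>R x) = r *\<^sub>R (c *\<^sub>C x)" for x :: "'a::complex_inner"
  by (simp add: scaleC_of_real[symmetric] scaleC_scaleC mult.commute)

lemma norm_scaleC: "norm (c *\<^sub>C x) = cmod c * norm x" for x :: "'a::complex_inner"
proof -
  have "cinner (c *\<^sub>C x) (c *\<^sub>C x) = c * cnj (cinner (c *\<^sub>C x) x)"
    by (metis cinner_commute cinner_scaleC_left)
  also have "\<dots> = (c * cnj c) * cinner x x"
    by (metis cinner_commute cinner_scaleC_left complex_cnj_mult mult.assoc)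
  also have "\<dots> = complex_of_real ((cmod c)\<^sup>2 * (norm x)\<^sup>2)"
    by (simp add: cinner_self complex_norm_square[symmetric])
  finally have "complex_of_real ((norm (c *\<^sub>C x))\<^sup>2) = complex_of_real ((cmod c)\<^sup>2 * (norm x)\<^sup>2)"
    by (simp add: cinner_self)
  then have "(norm (c *\<^sub>C x))\<^sup>2 = (cmod c * norm x)\<^sup>2"
    by (simp only: of_real_eq_iff power_mult_distrib)
  then show ?thesis
    by (simp add: power2_eq_iff_nonneg)
qed

text \<open>A purely imaginary scalar contributes nothing to the real inner product, so energy
  estimates on the imaginary axis see only \<open>L\<close>.\<close>

lemma inner_scaleC_self: "inner (c *\<^sub>C x) x = Re c * (norm x)\<^sup>2" for x :: "'a::complex_inner"
  by (simp add: Re_cinner[symmetric] cinner_scaleC_left cinner_self del: of_real_power)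

lemma csubspace_0: "csubspace D \<Longrightarrow> 0 \<in> D"
  and csubspace_add: "csubspace D \<Longrightarrow> x \<in> D \<Longrightarrow> y \<in> D \<Longrightarrow> x + y \<in> D"
  and csubspace_scaleC: "csubspace D \<Longrightarrow> x \<in> D \<Longrightarrow> c *\<^sub>C x \<in> D"
  by (auto simp: csubspace_def)

lemma csubspace_scaleR: "csubspace D \<Longrightarrow> x \<in> D \<Longrightarrow> r *\<^sub>R x \<in> D"
  by (metis csubspace_scaleC scaleC_of_real)

lemma csubspace_diff: "csubspace D \<Longrightarrow> x \<in> D \<Longrightarrow> y \<in> D \<Longrightarrow> x - y \<in> D"
  using csubspace_add[of D x "- y"] csubspace_scaleC[of D y "- 1"] by simp

lemmas csubspace_intros = csubspace_0 csubspace_add csubspace_scaleC csubspace_scaleR csubspace_diff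

lemma clinear_on_csubspace: "clinear_on D f \<Longrightarrow> csubspace D"
  and clinear_on_add: "clinear_on D f \<Longrightarrow> x \<in> D \<Longrightarrow> y \<in> D \<Longrightarrow> f (x + y) = f x + f y"
  and clinear_on_scaleC: "clinear_on D f \<Longrightarrow> x \<in> D \<Longrightarrow> f (c *\<^sub>C x) = c *\<^sub>C f x"
  by (auto simp: clinear_on_def)

lemma clinear_on_scaleR: "clinear_on D f \<Longrightarrow> x \<in> D \<Longrightarrow> f (r *\<^sub>R x) = r *\<^sub>R f x"
  by (metis clinear_on_scaleC scaleC_of_real)

lemma clinear_on_0: "clinear_on D f \<Longrightarrow> f 0 = 0"
  using clinear_on_scaleR[of D f 0 0] by (simp add: clinear_on_csubspace csubspace_0)

lemma clinear_on_diff: "clinear_on D f \<Longrightarrow> x \<in> D \<Longrightarrow> y \<in> D \<Longrightarrow> f (x - y) = f x - f y"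
  using clinear_on_add[of D f x "- y"] clinear_on_scaleC[of D f y "- 1"]
    csubspace_scaleC[of D y "- 1"] by (simp add: clinear_on_csubspace)

lemmas clinear_on_simps = clinear_on_add clinear_on_diff clinear_on_scaleC clinear_on_scaleR

lemma scaleC_zero_right [simp]: "c *\<^sub>C 0 = (0::'a::complex_inner)"
  using scaleC_diff_right[of c "0::'a" 0] by simp

lemma csubspace_ker_on: "clinear_on D G \<Longrightarrow> csubspace (ker_on D G)"
  unfolding csubspace_def ker_on_def
  by (auto simp: clinear_on_simps clinear_on_0 intro: csubspace_intros[OF clinear_on_csubspace])

lemma clinear_on_subset: "clinear_on D f \<Longrightarrow> csubspace E \<Longrightarrow> E \<subseteq> D \<Longrightarrow> clinear_on E f"
  by (auto simp: clinear_on_def subset_iff)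

lemma clinear_on_resolvent_map:
  fixes A :: "'a::complex_inner \<Rightarrow> 'a"
  assumes "clinear_on D A"
  shows "clinear_on D (\<lambda>x. \<mu> *\<^sub>C x - A x)"
  using assms clinear_on_csubspace[OF assms] unfolding clinear_on_def[of D "\<lambda>x. \<mu> *\<^sub>C x - A x"]
  by (simp add: clinear_on_simps scaleC_add_right scaleC_diff_right scaleC_scaleC mult.commute)

lemma clinear_on_inj_on:
  assumes f: "clinear_on D f" and bound: "\<And>x. x \<in> D \<Longrightarrow> norm x \<le> C * norm (f x)"
  shows "inj_on f D"
proof (rule inj_onI)
  fix x y assume xy: "x \<in> D" "y \<in> D" "f x = f y"
  then have "norm (x - y) \<le> C * norm (f (x - y))"
    by (intro bound csubspace_diff clinear_on_csubspace[OF f])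
  then show "x = y"
    using xy by (simp add: clinear_on_diff[OF f])
qed

lemma bounded_clinearI:
  fixes f :: "'a::complex_inner \<Rightarrow> 'b::complex_inner"
  assumes "\<And>x y. f (x + y) = f x + f y" "\<And>c x. f (c *\<^sub>C x) = c *\<^sub>C f x"
    and "\<And>x. norm (f x) \<le> norm x * K"
  shows "bounded_clinear f"
  unfolding bounded_clinear_def
proof
  show "bounded_linear f"
    by (rule bounded_linear_intro[of f K]) (metis assms scaleC_of_real)+
qed (use assms in auto)

section \<open>Perturbation by contractions\<close>

text \<open>The affine map \<open>V x + f\<close> is a strict contraction, so Banach's fixed point
  theorem replaces the Neumann series.\<close>

lemma neumann_surj:
  fixes V :: "'a::banach \<Rightarrow> 'a"
  assumes diff: "\<And>x y. V (x - y) = V x - V y" and bound: "\<And>x. norm (V x) \<le> q * norm x"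
    and q: "q < 1"
  shows "\<exists>x. x - V x = f"
proof -
  have "\<exists>!x. V x + f = x"
  \<comment> \<open>The fixed point theorem wants a nonnegative factor, and a negative
    \<open>q\<close> is possible on the zero space.\<close>
  proof (rule banach_fix_type[of "max q 0"])
    show "\<forall>x y. dist (V x + f) (V y + f) \<le> max q 0 * dist x y"
    proof (intro allI)
      fix x y
      have "norm (V (x - y)) \<le> max q 0 * norm (x - y)"
        using bound[of "x - y"] by (rule order_trans) (simp add: mult_right_mono)
      then show "dist (V x + f) (V y + f) \<le> max q 0 * dist x y"
        by (simp add: dist_norm diff)
    qed
  qed (use q in auto)
  then show ?thesis
    by (metis add_diff_cancel_left')
qed

text \<open>The damped step \<open>u - \<rho> *\<^sub>R T u\<close> is a strict contraction:
  coercivity controls the cross term of its squared norm, boundedness the quadratic one.\<close>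

lemma lax_milgram:
  fixes T :: "'a::{real_inner, banach} \<Rightarrow> 'a"
  assumes T: "bounded_linear T" and c: "c > 0" and coercive: "\<And>u. inner (T u) u \<ge> c * (norm u)\<^sup>2"
  shows "\<exists>u. T u = f"
proof -
  obtain M where M: "M > 0" "\<And>u. norm (T u) \<le> norm u * M"
    using bounded_linear.pos_bounded[OF T] by auto
  interpret T: bounded_linear T by fact
  \<comment> \<open>Minimiser of 1 - 2 \<rho> c + \<rho>^2 M^2; the minimum is 1 - c^2 / M^2. The
    \<open>max 0\<close> in \<open>q\<close> keeps the square root nonnegative, since c > M can
    occur on the zero space.\<close>
  define \<rho> where "\<rho> = c / M\<^sup>2"
  have \<rho>: "\<rho> > 0"
    using c M by (simp add: \<rho>_def)
  define q where "q = sqrt (max 0 (1 - c\<^sup>2 / M\<^sup>2))"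
  have "\<exists>u. u - (u - \<rho> *\<^sub>R T u) = \<rho> *\<^sub>R f"
  proof (rule neumann_surj[of "\<lambda>u. u - \<rho> *\<^sub>R T u" q])
    show "q < 1"
      using c M by (simp add: q_def)
    show "x - y - \<rho> *\<^sub>R T (x - y) = x - \<rho> *\<^sub>R T x - (y - \<rho> *\<^sub>R T y)" for x y
      by (simp add: T.diff algebra_simps)
    fix u
    have "(norm (u - \<rho> *\<^sub>R T u))\<^sup>2 = (norm u)\<^sup>2 - 2 * \<rho> * inner (T u) u + \<rho>\<^sup>2 * (norm (T u))\<^sup>2"
      unfolding power2_norm_eq_inner
      by (simp add: inner_diff_left inner_diff_right inner_commute power2_eq_square algebra_simps)
    also have "\<dots> \<le> (norm u)\<^sup>2 - 2 * \<rho> * (c * (norm u)\<^sup>2) + \<rho>\<^sup>2 * (norm u * M)\<^sup>2"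
      using \<rho> coercive[of u] M(2)[of u]
      by (intro add_mono diff_mono mult_left_mono power_mono) auto
    also have "\<dots> = (1 - c\<^sup>2 / M\<^sup>2) * (norm u)\<^sup>2"
      using M by (simp add: \<rho>_def field_simps power2_eq_square)
    also have "\<dots> \<le> (q * norm u)\<^sup>2"
      by (simp add: q_def power_mult_distrib mult_right_mono)
    finally show "norm (u - \<rho> *\<^sub>R T u) \<le> q * norm u"
      by (rule power2_le_imp_le) (simp add: q_def)
  qed
  then show ?thesis
    using \<rho> by auto
qed

section \<open>Resolvents\<close>

text \<open>Reduces membership in the resolvent set and the norm bound to solvability plus an a
  priori estimate, the form in which both are proved for the coupled operator.\<close>

lemma resolvent_setI:
  fixes A :: "'a::chilbert_space \<Rightarrow> 'a"
  assumes A: "clinear_on D A" and surj: "\<And>f. \<exists>x\<in>D. \<mu> *\<^sub>C x - A x = f"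
    and bound: "\<And>x. x \<in> D \<Longrightarrow> norm x \<le> C * norm (\<mu> *\<^sub>C x - A x)"
  shows "\<mu> \<in> resolvent_set D A" and "0 \<le> C \<Longrightarrow> onorm (resolvent D A \<mu>) \<le> C"
proof -
  let ?R = "resolvent D A \<mu>"
  define F where "F = (\<lambda>x. \<mu> *\<^sub>C x - A x)"
  have F: "clinear_on D F"
    unfolding F_def by (rule clinear_on_resolvent_map[OF A])
  note D = clinear_on_csubspace[OF A]
  have inj: "inj_on F D"
    by (rule clinear_on_inj_on[OF F, of C]) (simp add: F_def bound)
  have bij: "bij_betw F D UNIV"
    unfolding bij_betw_def
  proof
    show "F ` D = UNIV"
      unfolding F_def using surj by (metis (no_types, lifting) UNIV_eq_I image_eqI)
  qed (rule inj)
  have R: "?R f \<in> D" "F (?R f) = f" for f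
    using bij inv_into_into[of f F D] f_inv_into_f[of f F D]
    by (auto simp: resolvent_def bij_betw_def F_def)
  have Rb: "norm (?R f) \<le> norm f * C" for f
    using bound[OF R(1)[of f]] R(2)[of f] by (simp add: mult.commute F_def)
  have "bounded_clinear ?R"
  proof (rule bounded_clinearI)
    show "?R (f + g) = ?R f + ?R g" for f g
      by (rule inj_onD[OF inj]) (simp_all add: R clinear_on_add[OF F] csubspace_add[OF D])
    show "?R (c *\<^sub>C f) = c *\<^sub>C ?R f" for c f
      by (rule inj_onD[OF inj]) (simp_all add: R clinear_on_scaleC[OF F] csubspace_scaleC[OF D])
  qed (use Rb in auto)
  then show "\<mu> \<in> resolvent_set D A"
    using bij by (simp add: resolvent_set_def F_def)
  show "onorm ?R \<le> C" if "0 \<le> C"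
    by (rule onorm_bound[OF that]) (use Rb in \<open>simp add: mult.commute\<close>)
qed

lemma resolvent_setD:
  fixes A :: "'a::chilbert_space \<Rightarrow> 'a"
  assumes "\<mu> \<in> resolvent_set D A"
  shows "\<And>f. \<exists>x\<in>D. \<mu> *\<^sub>C x - A x = f"
    and "\<And>x. x \<in> D \<Longrightarrow> norm x \<le> onorm (resolvent D A \<mu>) * norm (\<mu> *\<^sub>C x - A x)"
proof -
  have bij: "bij_betw (\<lambda>x. \<mu> *\<^sub>C x - A x) D UNIV" and b: "bounded_linear (resolvent D A \<mu>)"
    using assms by (auto simp: resolvent_set_def bounded_clinear_def)
  show "\<exists>x\<in>D. \<mu> *\<^sub>C x - A x = f" for f
    using bij_betw_imp_surj_on[OF bij] by (metis (no_types, lifting) UNIV_I imageE)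
  fix x assume "x \<in> D"
  then have "resolvent D A \<mu> (\<mu> *\<^sub>C x - A x) = x"
    using inv_into_f_f[OF bij_betw_imp_inj_on[OF bij] \<open>x \<in> D\<close>] by (simp add: resolvent_def)
  then show "norm x \<le> onorm (resolvent D A \<mu>) * norm (\<mu> *\<^sub>C x - A x)"
    using onorm[OF b, of "\<mu> *\<^sub>C x - A x"] by simp
qed

text \<open>With R the inverse at \<mu>, (\<nu> - A) R = I - (\<mu> - \<nu>) R, which is onto by the
  Neumann argument.\<close>

lemma resolvent_perturb:
  fixes A :: "'a::chilbert_space \<Rightarrow> 'a"
  assumes A: "clinear_on D A" and surj: "\<And>f. \<exists>x\<in>D. \<mu> *\<^sub>C x - A x = f"
    and bound: "\<And>x. x \<in> D \<Longrightarrow> norm x \<le> C * norm (\<mu> *\<^sub>C x - A x)"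
    and \<nu>: "cmod (\<mu> - \<nu>) * C < 1"
  shows "\<exists>x\<in>D. \<nu> *\<^sub>C x - A x = f"
proof -
  note D = clinear_on_csubspace[OF A]
  note F = clinear_on_resolvent_map[OF A, of \<mu>]
  obtain R where R: "\<And>f. R f \<in> D" "\<And>f. \<mu> *\<^sub>C R f - A (R f) = f"
    using surj by metis
  have Rd: "R (x - y) = R x - R y" for x y
    by (rule inj_onD[OF clinear_on_inj_on[OF F bound]])
      (simp_all add: R clinear_on_diff[OF F] csubspace_diff[OF D] del: scaleC_diff_right)
  have Rb: "norm (R f) \<le> C * norm f" for f
    using bound[OF R(1)[of f]] R(2)[of f] by simp
  let ?V = "\<lambda>x. (\<mu> - \<nu>) *\<^sub>C R x"
  obtain g where g: "g - ?V g = f"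
  proof -
    have "\<exists>g. g - ?V g = f"
    proof (rule neumann_surj)
      show "norm (?V x) \<le> (cmod (\<mu> - \<nu>) * C) * norm x" for x
        using mult_left_mono[OF Rb, of "cmod (\<mu> - \<nu>)"] by (simp add: norm_scaleC mult.assoc)
    qed (use \<nu> in \<open>auto simp: Rd scaleC_diff_right\<close>)
    then show ?thesis
      using that by blast
  qed
  show ?thesis
  proof (rule bexI[of _ "R g"])
    show "\<nu> *\<^sub>C R g - A (R g) = f"
      using R(2)[of g] g by (simp add: scaleC_diff_left algebra_simps)
  qed (rule R)
qed

section \<open>The range of a generator\<close>

text \<open>A Baire category argument: strong continuity at 0 bounds each orbit on some short
  interval, and category makes interval and bound uniform in \<open>x\<close>.\<close>

lemma C0_semigroup_locally_bounded:
  fixes T :: "real \<Rightarrow> 'a::chilbert_space \<Rightarrow> 'a"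
  assumes T: "C0_semigroup T"
  obtains \<delta> M where "\<delta> > 0" "M \<ge> 1" "\<And>t x. 0 \<le> t \<Longrightarrow> t \<le> \<delta> \<Longrightarrow> norm (T t x) \<le> M * norm x"
proof -
  have lin: "bounded_linear (T t)" if "t \<ge> 0" for t
    using T that by (simp add: C0_semigroup_def bounded_clinear_def)
  have T0: "T 0 = id" and lim: "((\<lambda>t. T t x) \<longlongrightarrow> x) (at_right 0)" for x
    using T by (auto simp: C0_semigroup_def)
  \<comment> \<open>One index serves as the bound and as the inverse length of the time interval, so
    countably many closed sets cover the space.\<close>
  define F where "F n = {x. \<forall>t\<in>{0<..1 / real (Suc n)}. norm (T t x) \<le> real (Suc n)}" for n
  have closed: "closed (F n)" for n
  proof -
    have "closed {x. norm (T t x) \<le> real (Suc n)}" if "t > 0" for t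
      using bounded_linear.continuous_on[OF lin continuous_on_id, of t UNIV] that
      by (intro closed_Collect_le continuous_intros) auto
    then have "closed (\<Inter>t\<in>{0<..1 / real (Suc n)}. {x. norm (T t x) \<le> real (Suc n)})"
      by (intro closed_INT) auto
    moreover have "F n = (\<Inter>t\<in>{0<..1 / real (Suc n)}. {x. norm (T t x) \<le> real (Suc n)})"
      by (auto simp: F_def)
    ultimately show ?thesis by simp
  qed
  have cover: "x \<in> \<Union>(range F)" for x
  proof -
    have "\<forall>\<^sub>F t in at_right 0. dist (T t x) x < 1"
      using lim by (rule tendstoD) simp
    then obtain b where b: "b > 0" "\<And>t. 0 < t \<Longrightarrow> t < b \<Longrightarrow> dist (T t x) x < 1"
      by (auto simp: eventually_at_right_field)
    obtain m where m: "1 / real (Suc m) < b"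
      using reals_Archimedean[OF b(1)] by (auto simp: inverse_eq_divide)
    obtain k where k: "norm x + 1 < real k"
      using reals_Archimedean2 by blast
    define n where "n = max m k"
    have "norm (T t x) \<le> real (Suc n)" if t: "t \<in> {0<..1 / real (Suc n)}" for t
    proof -
      have "1 / real (Suc n) \<le> 1 / real (Suc m)"
        by (simp add: n_def field_simps)
      then have "dist (T t x) x < 1"
        using t m by (intro b(2)) auto
      then have "norm (T t x) \<le> norm x + 1"
        using norm_triangle_sub[of "T t x" x] by (simp add: dist_norm)
      also have "\<dots> \<le> real (Suc n)"
        using k by (simp add: n_def)
      finally show ?thesis .
    qed
    then show ?thesis
      unfolding F_def by blast
  qed
  have "\<exists>n. interior (F n) \<noteq> {}"
  proof (rule ccontr)
    assume "\<not> ?thesis"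
    then have "euclidean interior_of \<Union>(range F) = {}"
      using closed by (intro Baire_category_alt disjI1 completely_metrizable_space_euclidean) auto
    moreover have "\<Union>(range F) = UNIV"
      using cover by auto
    ultimately show False
      by simp
  qed
  then obtain n x0 where "x0 \<in> interior (F n)"
    by blast
  then obtain e where e: "e > 0" "ball x0 e \<subseteq> F n"
    by (auto simp: mem_interior)
  let ?N = "real (Suc n)"
  \<comment> \<open>The difference of two points of the ball gives the bound 2 \<open>?N\<close> on
    a vector of length e / 2, whence the factor 4.\<close>
  define M where "M = max 1 (4 * ?N / e)"
  have bound: "norm (T t x) \<le> M * norm x" if t: "t \<in> {0<..1 / ?N}" for t x
  proof (cases "x = 0")
    case False
    interpret Tt: bounded_linear "T t"
      using t by (intro lin) auto
    define c where "c = e / (2 * norm x)"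
    have c: "c > 0"
      using e False by (simp add: c_def)
    have "x0 + c *\<^sub>R x \<in> ball x0 e" "x0 \<in> ball x0 e"
      using e False by (auto simp: dist_norm c_def)
    then have "norm (T t (x0 + c *\<^sub>R x)) \<le> ?N" "norm (T t x0) \<le> ?N"
      using e(2) t unfolding F_def by blast+
    then have "norm (T t (c *\<^sub>R x)) \<le> 2 * ?N"
      using norm_triangle_ineq4[of "T t (x0 + c *\<^sub>R x)" "T t x0"] by (simp add: Tt.add)
    then have "norm (T t x) \<le> 2 * ?N / c"
      using c by (simp add: Tt.scaleR pos_le_divide_eq mult.commute)
    also have "\<dots> = 4 * ?N / e * norm x"
      using False e by (simp add: c_def field_simps)
    also have "\<dots> \<le> M * norm x"
      by (intro mult_right_mono) (auto simp: M_def)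
    finally show ?thesis .
  next
    case True
    then show ?thesis
      using lin[of t] t by (simp add: bounded_linear.linear linear_0)
  qed
  show ?thesis
  proof (rule that[of "1 / ?N" M])
    show "norm (T t x) \<le> M * norm x" if "0 \<le> t" "t \<le> 1 / ?N" for t x
    proof (cases "t = 0")
      case True
      have "1 * norm x \<le> M * norm x"
        by (intro mult_right_mono) (auto simp: M_def)
      with True show ?thesis
        by (simp add: T0)
    qed (use bound that in auto)
  qed (auto simp: M_def)
qed

lemma average_integral_tendsto:
  fixes f :: "real \<Rightarrow> 'a::banach"
  assumes f: "continuous_on {a..b} f" and ab: "a < b"
  shows "((\<lambda>h. integral {a..a + h} f /\<^sub>R h) \<longlongrightarrow> f a) (at_right 0)"
proof -
  have "((\<lambda>u. integral {a..u} f) has_vector_derivative f a) (at a within {a..b})"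
    using ab by (intro integral_has_vector_derivative[OF f]) auto
  then have "((\<lambda>u. (integral {a..u} f - (u - a) *\<^sub>R f a) /\<^sub>R norm (u - a)) \<longlongrightarrow> 0) (at_right a)"
    using ab by (simp add: has_vector_derivative_def has_derivative_within at_within_Icc_at_right
        divide_inverse_commute diff_diff_eq)
  then have "((\<lambda>h. (integral {a..h + a} f - h *\<^sub>R f a) /\<^sub>R \<bar>h\<bar>) \<longlongrightarrow> 0) (at_right 0)"
    by (subst (asm) filterlim_at_right_to_0) simp
  then have "((\<lambda>h. (integral {a..h + a} f - h *\<^sub>R f a) /\<^sub>R \<bar>h\<bar> + f a) \<longlongrightarrow> 0 + f a) (at_right 0)"
    by (intro tendsto_intros)
  then show ?thesis
  proof (rule tendsto_eq_rhs[OF Lim_transform_eventually], unfold eventually_at_right_field)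
    show "\<exists>b>0. \<forall>h>0. h < b \<longrightarrow> (integral {a..h + a} f - h *\<^sub>R f a) /\<^sub>R \<bar>h\<bar> + f a = integral {a..a + h} f /\<^sub>R h"
      by (intro exI[of _ 1]) (auto simp: scaleR_diff_right add.commute)
  qed simp
qed

text \<open>Both one-sided increments are \<open>T r (T h x - x)\<close> with \<open>r\<close> the
  earlier time, so right continuity at 0 and the uniform bound also give left continuity.\<close>

lemma C0_semigroup_orbit_continuous:
  fixes T :: "real \<Rightarrow> 'a::chilbert_space \<Rightarrow> 'a"
  assumes T: "C0_semigroup T"
    and bound: "\<And>t x. 0 \<le> t \<Longrightarrow> t \<le> \<delta> \<Longrightarrow> norm (T t x) \<le> M * norm x"
  shows "continuous_on {0..\<delta>} (\<lambda>t. T t x)"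
  unfolding continuous_on_iff
proof (intro ballI allI impI)
  fix t e :: real assume t: "t \<in> {0..\<delta>}" and e: "e > 0"
  have M: "M * norm y \<ge> 0" for y :: 'a
    using bound[of 0 y] t by (meson atLeastAtMost_iff norm_ge_zero order_trans order_refl)
  have est: "norm (T (r + h) x - T r x) \<le> M * norm (T h x - x)" if "0 \<le> r" "0 \<le> h" "r + h \<le> \<delta>" for r h
  proof -
    have "bounded_linear (T r)" "T (r + h) = T r \<circ> T h"
      using T that by (auto simp: C0_semigroup_def bounded_clinear_def)
    then have "T (r + h) x - T r x = T r (T h x - x)"
      by (simp add: bounded_linear.linear linear_diff)
    then show ?thesis
      using bound[of r] that by simp
  qed
  have "((\<lambda>h. M * norm (T h x - x)) \<longlongrightarrow> M * norm (x - x)) (at_right 0)"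
    using T by (intro tendsto_intros) (simp add: C0_semigroup_def)
  then have "\<forall>\<^sub>F h in at_right 0. dist (M * norm (T h x - x)) (M * norm (x - x)) < e"
    using e by (rule tendstoD)
  then obtain d where d: "d > 0" "\<And>h. 0 < h \<Longrightarrow> h < d \<Longrightarrow> M * norm (T h x - x) < e"
    unfolding eventually_at_right_field by (auto simp: dist_real_def abs_less_iff)
  have "dist (T s x) (T t x) < e" if s: "s \<in> {0..\<delta>}" "dist s t < d" for s
  proof (rule linorder_cases[of s t])
    assume "s < t"
    then show ?thesis
      using est[of s "t - s"] d(2)[of "t - s"] s t by (simp add: dist_norm norm_minus_commute)
  next
    assume "t < s"
    then show ?thesis
      using est[of t "s - t"] d(2)[of "s - t"] s t by (simp add: dist_norm)
  qed (use e in auto)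
  then show "\<exists>d>0. \<forall>s\<in>{0..\<delta>}. dist s t < d \<longrightarrow> dist (T s x) (T t x) < e"
    using d(1) by blast
qed

text \<open>
  The truncated Laplace transform \<open>y = \<integral>\<^sub>0\<^sup>t exp (- \<mu> s) T(s) x ds\<close> satisfies
  \<open>\<mu> y - A y = x - exp (- \<mu> t) T(t) x\<close>, and for large \<open>\<mu>\<close> the right-hand side is an
  invertible function of \<open>x\<close>; no growth bound of the semigroup is needed.
\<close>

lemma generator_surj:
  fixes T :: "real \<Rightarrow> 'a::chilbert_space \<Rightarrow> 'a"
  assumes T: "C0_semigroup T" and gen: "is_generator T D A"
  obtains \<mu>0 where "\<mu>0 > 0" "\<And>\<mu> f. \<mu> \<ge> \<mu>0 \<Longrightarrow> \<exists>x\<in>D. \<mu> *\<^sub>R x - A x = f"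
proof -
  obtain \<delta> M where \<delta>: "\<delta> > 0" and M: "M \<ge> 1"
    and bound: "\<And>t x. 0 \<le> t \<Longrightarrow> t \<le> \<delta> \<Longrightarrow> norm (T t x) \<le> M * norm x"
    using C0_semigroup_locally_bounded[OF T] by blast
  \<comment> \<open>Half of the interval is kept in reserve, so that t + h \<le> \<delta> for all h
    \<le> t in the difference quotients.\<close>
  define t where "t = \<delta> / 2"
  have t: "t > 0" "t + t = \<delta>"
    using \<delta> by (auto simp: t_def)
  have lin: "bounded_linear (T s)" if "s \<ge> 0" for s
    using T that by (simp add: C0_semigroup_def bounded_clinear_def)
  have T0: "T 0 = id" and Tadd: "\<And>s r. s \<ge> 0 \<Longrightarrow> r \<ge> 0 \<Longrightarrow> T (s + r) = T s \<circ> T r"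
    using T by (auto simp: C0_semigroup_def)
  have key: "\<exists>y\<in>D. \<mu> *\<^sub>R y - A y = x - exp (- \<mu> * t) *\<^sub>R T t x" for \<mu> x
  proof -
    define S where "S s = exp (- \<mu> * s) *\<^sub>R T s x" for s
    define y where "y = integral {0..t} S"
    have cont: "continuous_on {0..\<delta>} S"
      unfolding S_def
      by (intro continuous_intros C0_semigroup_orbit_continuous[OF T bound]) auto
    have intS: "S integrable_on {a..b}" if "0 \<le> a" "b \<le> \<delta>" for a b
      by (rule integrable_continuous_real, rule continuous_on_subset[OF cont]) (use that in auto)
    have Ty: "T h y = exp (\<mu> * h) *\<^sub>R (y + integral {t..t + h} S - integral {0..0 + h} S)"
      if h: "0 < h" "h \<le> t" for h
    proof -
      \<comment> \<open>This operator carries \<open>S s\<close> to \<open>S (s + h)\<close>, so on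
        \<open>y\<close> it only shifts the interval of integration; the two end pieces become
        \<open>S t\<close> and \<open>S 0\<close> in the limit. Writing \<open>0 + h\<close> matches
        \<open>average_integral_tendsto\<close> at the left endpoint 0.\<close>
      have "bounded_linear (\<lambda>z. exp (- \<mu> * h) *\<^sub>R T h z)"
        using lin[of h] h by (intro bounded_linear_const_scaleR) auto
      then have "exp (- \<mu> * h) *\<^sub>R T h y = integral {0..t} ((\<lambda>z. exp (- \<mu> * h) *\<^sub>R T h z) \<circ> S)"
        unfolding y_def using t intS[of 0 t] by (subst integral_linear) auto
      also have "\<dots> = integral {0..t} (S \<circ> (+) h)"
      proof (rule integral_cong)
        fix s assume s: "s \<in> {0..t}"
        have "T h (S s) = exp (- \<mu> * s) *\<^sub>R T h (T s x)"
          using lin[of h] h by (simp add: S_def bounded_linear.linear linear_cmul)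
        then show "((\<lambda>z. exp (- \<mu> * h) *\<^sub>R T h z) \<circ> S) s = (S \<circ> (+) h) s"
          using s h by (simp add: S_def Tadd exp_add[symmetric] algebra_simps)
      qed
      also have "\<dots> = integral {h..t + h} S"
        by (subst integral_shift_Icc_real) simp
      also have "\<dots> = y + integral {t..t + h} S - integral {0..0 + h} S"
        using Henstock_Kurzweil_Integration.integral_combine[of 0 h "t + h" S]
          Henstock_Kurzweil_Integration.integral_combine[of 0 t "t + h" S]
          h t intS[of 0 "t + h"] by (simp add: y_def algebra_simps)
      finally have "exp (\<mu> * h) *\<^sub>R (exp (- \<mu> * h) *\<^sub>R T h y)
        = exp (\<mu> * h) *\<^sub>R (y + integral {t..t + h} S - integral {0..0 + h} S)"
        by simp
      then show ?thesis
        by (simp add: exp_add[symmetric])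
    qed
    have e1: "((\<lambda>h. (exp (\<mu> * h) - 1) / h) \<longlongrightarrow> \<mu>) (at_right 0)"
    proof -
      have "((\<lambda>h. exp (\<mu> * h)) has_real_derivative \<mu>) (at 0)"
        by (auto intro!: derivative_eq_intros)
      then have "((\<lambda>h. (exp (\<mu> * h) - 1) / h) \<longlongrightarrow> \<mu>) (at 0)"
        by (simp add: DERIV_def)
      then show ?thesis
        by (rule tendsto_mono[rotated]) (simp add: at_le)
    qed
    have "((\<lambda>h. exp (\<mu> * h) *\<^sub>R (integral {t..t + h} S /\<^sub>R h - integral {0..0 + h} S /\<^sub>R h)
          + ((exp (\<mu> * h) - 1) / h) *\<^sub>R y)
        \<longlongrightarrow> exp (\<mu> * 0) *\<^sub>R (S t - S 0) + \<mu> *\<^sub>R y) (at_right 0)"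
      using \<delta> t by (intro tendsto_intros e1 average_integral_tendsto[of _ \<delta>]
          continuous_on_subset[OF cont]) auto
    then have lim: "((\<lambda>h. (T h y - y) /\<^sub>R h) \<longlongrightarrow> S t - S 0 + \<mu> *\<^sub>R y) (at_right 0)"
    proof (rule tendsto_eq_rhs[OF Lim_transform_eventually], unfold eventually_at_right_field)
      show "\<exists>b>0. \<forall>h>0. h < b \<longrightarrow>
          exp (\<mu> * h) *\<^sub>R (integral {t..t + h} S /\<^sub>R h - integral {0..0 + h} S /\<^sub>R h)
            + ((exp (\<mu> * h) - 1) / h) *\<^sub>R y = (T h y - y) /\<^sub>R h"
      proof (intro exI[of _ t] conjI allI impI t(1))
        fix h assume "0 < h" "h < t"
        then show "exp (\<mu> * h) *\<^sub>R (integral {t..t + h} S /\<^sub>R h - integral {0..0 + h} S /\<^sub>R h)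
            + ((exp (\<mu> * h) - 1) / h) *\<^sub>R y = (T h y - y) /\<^sub>R h"
          unfolding Ty[OF \<open>0 < h\<close> less_imp_le[OF \<open>h < t\<close>]]
          by (simp add: algebra_simps divide_inverse)
      qed
    qed simp
    have yD: "y \<in> D"
      using gen lim by (auto simp: is_generator_def)
    have "((\<lambda>h. (T h y - y) /\<^sub>R h) \<longlongrightarrow> A y) (at_right 0)"
      using gen yD by (auto simp: is_generator_def)
    then have "A y = S t - S 0 + \<mu> *\<^sub>R y"
      using lim by (rule tendsto_unique[rotated]) simp
    then show ?thesis
      using yD by (intro bexI[of _ y]) (auto simp: S_def T0)
  qed
  show ?thesis
  proof (rule that[of "M / t"])
    show "M / t > 0"
      using M t by simp
    fix \<mu> f assume \<mu>: "\<mu> \<ge> M / t"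
    \<comment> \<open>The threshold M / t makes exp(\<mu> t) \<ge> 1 + \<mu> t > M, hence exp(-\<mu>
      t) T(t) is a strict contraction.\<close>
    have "M * exp (- \<mu> * t) < 1"
    proof -
      have "M < 1 + \<mu> * t"
        using \<mu> t by (simp add: field_simps)
      also have "\<dots> \<le> exp (\<mu> * t)"
        by (rule exp_ge_add_one_self)
      finally show ?thesis
        by (simp add: exp_minus field_simps)
    qed
    then obtain x where "x - exp (- \<mu> * t) *\<^sub>R T t x = f"
      using neumann_surj[of "\<lambda>x. exp (- \<mu> * t) *\<^sub>R T t x" "exp (- \<mu> * t) * M" f] lin[of t] t bound[of t]
      by (auto simp: bounded_linear.linear linear_diff scaleR_diff_right mult.commute)
    then show "\<exists>x\<in>D. \<mu> *\<^sub>R x - A x = f"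
      using key[of \<mu> x] by simp
  qed
qed

section \<open>Generation of contraction semigroups\<close>

text \<open>The projection theorem in disguise: a minimising sequence in \<open>D\<close> is Cauchy
  by the parallelogram law, and \<open>z\<close> minus its limit is orthogonal to
  \<open>D\<close>.\<close>

lemma dense_if_orthogonal_trivial:
  fixes D :: "'a::chilbert_space set"
  assumes D: "csubspace D" and orth: "\<And>z. (\<And>v. v \<in> D \<Longrightarrow> inner z v = 0) \<Longrightarrow> z = 0"
  shows "closure D = UNIV"
proof -
  have "z \<in> closure D" for z
  proof -
    define d where "d = (INF v\<in>D. (norm (z - v))\<^sup>2)"
    have ne: "(\<lambda>v. (norm (z - v))\<^sup>2) ` D \<noteq> {}"
      using csubspace_0[OF D] by auto
    have bdd: "bdd_below ((\<lambda>v. (norm (z - v))\<^sup>2) ` D)"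
      by (rule bdd_belowI[of _ 0]) auto
    have lower: "d \<le> (norm (z - v))\<^sup>2" if "v \<in> D" for v
      unfolding d_def using bdd that by (rule cINF_lower)
    have "\<exists>v\<in>D. (norm (z - v))\<^sup>2 < d + 1 / real (Suc n)" for n
    proof -
      have "d < d + 1 / real (Suc n)"
        by simp
      then show ?thesis
        unfolding d_def using cInf_lessD[OF ne] by blast
    qed
    then obtain x where x: "\<And>n. x n \<in> D" "\<And>n. (norm (z - x n))\<^sup>2 < d + 1 / real (Suc n)"
      by metis
    have close: "(norm (x n - x m))\<^sup>2 \<le> 2 / real (Suc n) + 2 / real (Suc m)" for n m
    proof -
      have "(norm (x n - x m))\<^sup>2 = 2 * (norm (z - x n))\<^sup>2 + 2 * (norm (z - x m))\<^sup>2
          - 4 * (norm (z - (1/2) *\<^sub>R (x n + x m)))\<^sup>2"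
        unfolding power2_norm_eq_inner
        by (simp add: inner_diff_left inner_diff_right inner_add_left inner_add_right inner_commute
            field_simps)
      moreover have "d \<le> (norm (z - (1/2) *\<^sub>R (x n + x m)))\<^sup>2"
        by (intro lower csubspace_intros[OF D] x)
      ultimately show ?thesis
        using x(2)[of n] x(2)[of m] by linarith
    qed
    have "Cauchy x"
      unfolding Cauchy_altdef2
    proof (intro allI impI)
      fix e :: real assume "e > 0"
      obtain N where N: "4 / e\<^sup>2 < real N"
        using reals_Archimedean2 by blast
      have "dist (x n) (x N) < e" if "n \<ge> N" for n
      proof -
        have "(dist (x n) (x N))\<^sup>2 \<le> 2 / real (Suc n) + 2 / real (Suc N)"
          using close[of n N] by (simp add: dist_norm)
        also have "\<dots> \<le> 2 / real (Suc N) + 2 / real (Suc N)"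
          using that by (intro add_mono divide_left_mono) auto
        also have "\<dots> = 4 / real (Suc N)"
          by simp
        also have "\<dots> < e\<^sup>2"
        proof -
          have "4 < real N * e\<^sup>2"
            using N \<open>e > 0\<close> by (simp add: pos_divide_less_eq)
          also have "\<dots> \<le> real (Suc N) * e\<^sup>2"
            by (intro mult_right_mono) auto
          finally show ?thesis
            by (simp add: pos_divide_less_eq mult.commute)
        qed
        finally show ?thesis
          using \<open>e > 0\<close> by (simp add: power_less_imp_less_base)
      qed
      then show "\<exists>N. \<forall>n\<ge>N. dist (x n) (x N) < e"
        by blast
    qed
    then obtain p where p: "x \<longlonglongrightarrow> p"
      using Cauchy_convergent convergent_def by blast
    have "inner (z - p) v = 0" if v: "v \<in> D" for v
    proof -
      have var: "(norm (z - p))\<^sup>2 \<le> (norm (z - p - t *\<^sub>R v))\<^sup>2" for t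
      proof (rule LIMSEQ_le)
        show "(\<lambda>n. (norm (z - x n))\<^sup>2 - 1 / real (Suc n)) \<longlonglongrightarrow> (norm (z - p))\<^sup>2"
        proof -
          have "(\<lambda>n. (norm (z - x n))\<^sup>2 - inverse (real (Suc n))) \<longlonglongrightarrow> (norm (z - p))\<^sup>2 - 0"
            by (intro tendsto_intros p LIMSEQ_inverse_real_of_nat)
          then show ?thesis
            by (simp add: divide_inverse)
        qed
        show "(\<lambda>n. (norm (z - x n - t *\<^sub>R v))\<^sup>2) \<longlonglongrightarrow> (norm (z - p - t *\<^sub>R v))\<^sup>2"
          by (intro tendsto_intros p)
        have "(norm (z - x n))\<^sup>2 - 1 / real (Suc n) \<le> (norm (z - x n - t *\<^sub>R v))\<^sup>2" for n
          using x(2)[of n] lower[of "x n + t *\<^sub>R v"] x(1)[of n] v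
          by (auto simp: csubspace_intros[OF D] diff_diff_eq)
        then show "\<exists>N. \<forall>n\<ge>N. (norm (z - x n))\<^sup>2 - 1 / real (Suc n) \<le> (norm (z - x n - t *\<^sub>R v))\<^sup>2"
          by blast
      qed
      have quad: "0 \<le> t\<^sup>2 * (norm v)\<^sup>2 - 2 * t * inner (z - p) v" for t
        using var[of t] unfolding power2_norm_eq_inner
        by (simp add: inner_diff_left inner_diff_right inner_commute power2_eq_square algebra_simps)
      \<comment> \<open>Close to the minimiser of the quadratic in \<open>t\<close>; the added 1
        keeps the denominator positive when v = 0 and still forces t = 0.\<close>
      define t where "t = inner (z - p) v / (1 + (norm v)\<^sup>2)"
      have a: "inner (z - p) v = t * (1 + (norm v)\<^sup>2)"
        by (simp add: t_def add_pos_nonneg less_imp_neq[THEN not_sym])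
      have "t\<^sup>2 * (norm v)\<^sup>2 + 2 * t\<^sup>2 \<le> 0"
        using quad[of t] unfolding a by (simp add: power2_eq_square algebra_simps)
      then have "2 * t\<^sup>2 \<le> 0"
        using mult_nonneg_nonneg[of "t\<^sup>2" "(norm v)\<^sup>2"] zero_le_power2[of t] zero_le_power2[of "norm v"]
        by linarith
      then show ?thesis
        by (simp add: a)
    qed
    then have "z = p"
      using orth[of "z - p"] by simp
    then show ?thesis
      using p x(1) closure_sequential by blast
  qed
  then show ?thesis
    by auto
qed

lemma norm_add_diff_le:
  fixes a b c :: "'a::real_normed_vector"
  assumes "norm a \<le> r" "norm b \<le> s" "norm c \<le> t"
  shows "norm (a + b - c) \<le> r + s + t"
  using norm_triangle_ineq4[of "a + b" c] norm_triangle_ineq[of a b] assms by linarith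

text \<open>Telescoping: each step adds a local error \<open>c * N x\<close>, and the contraction
  \<open>P\<close> does not amplify earlier ones. \<open>N\<close> measures regularity, typically
  the norm of \<open>A (A x)\<close>, and is not increased by \<open>Q\<close>.\<close>

lemma funpow_diff_le:
  fixes P Q :: "'a::real_normed_vector \<Rightarrow> 'a"
  assumes P: "\<And>x y. P (x - y) = P x - P y" "\<And>x. norm (P x) \<le> norm x"
    and Q: "\<And>x. x \<in> E \<Longrightarrow> Q x \<in> E \<and> N (Q x) \<le> N x"
    and diff: "\<And>x. x \<in> E \<Longrightarrow> norm (P x - Q x) \<le> c * N x" and c: "c \<ge> 0" and x: "x \<in> E"
  shows "norm ((P ^^ n) x - (Q ^^ n) x) \<le> real n * (c * N x)"
proof -
  have inv: "(Q ^^ n) x \<in> E \<and> N ((Q ^^ n) x) \<le> N x" for n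
    by (induction n) (use Q x in \<open>auto intro: order_trans\<close>)
  show ?thesis
  proof (induction n)
    case (Suc n)
    let ?p = "(P ^^ n) x" and ?q = "(Q ^^ n) x"
    have "norm ((P ^^ Suc n) x - (Q ^^ Suc n) x) = norm (P (?p - ?q) + (P ?q - Q ?q))"
      by (simp add: P(1))
    also have "\<dots> \<le> norm (?p - ?q) + c * N ?q"
      using P(2) diff[of ?q] inv by (intro norm_triangle_mono) auto
    also have "\<dots> \<le> real n * (c * N x) + c * N x"
      using Suc inv c by (intro add_mono mult_left_mono) auto
    finally show ?case
      by (simp add: algebra_simps)
  qed simp
qed

lemma funpow_commute_comp:
  assumes "f \<circ> g = g \<circ> f"
  shows "((f \<circ> g) ^^ n) x = (f ^^ n) ((g ^^ n) x)"
proof (induction n)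
  case (Suc n)
  have "g ((f ^^ n) y) = (f ^^ n) (g y)" for y
  proof (induction n)
    case (Suc n)
    have "g (f z) = f (g z)" for z
      using assms by (metis comp_apply)
    with Suc show ?case
      by simp
  qed simp
  with Suc show ?case
    by simp
qed simp

section \<open>Backward Euler steps of an m-dissipative operator\<close>

locale m_dissipative =
  fixes D :: "'a::chilbert_space set" and A :: "'a \<Rightarrow> 'a"
  assumes clinear_A: "clinear_on D A"
    and dissipative: "\<And>x. x \<in> D \<Longrightarrow> inner (A x) x \<le> 0"
    and surj: "\<And>h f. h > 0 \<Longrightarrow> \<exists>x\<in>D. x - h *\<^sub>R A x = f"
begin

lemmas csubspace_D = clinear_on_csubspace[OF clinear_A]

lemma clinear_on_implicit_map: "clinear_on D (\<lambda>x. x - h *\<^sub>R A x)"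
  unfolding clinear_on_def
  by (auto simp: csubspace_D clinear_on_simps[OF clinear_A] scaleC_diff_right scaleC_scaleR scaleR_add_right)

lemma norm_le_implicit_map:
  assumes "h \<ge> 0" "x \<in> D"
  shows "norm x \<le> norm (x - h *\<^sub>R A x)"
proof (cases "x = 0")
  case False
  have "norm x * norm x \<le> inner (x - h *\<^sub>R A x) x"
    using dissipative[OF assms(2)] assms(1)
    by (simp add: inner_diff_left power2_norm_eq_inner[symmetric] power2_eq_square mult_nonneg_nonpos)
  also have "\<dots> \<le> norm (x - h *\<^sub>R A x) * norm x"
    by (rule norm_cauchy_schwarz)
  finally show ?thesis
    using False by simp
qed simp

lemma inj_on_implicit_map: "h \<ge> 0 \<Longrightarrow> inj_on (\<lambda>x. x - h *\<^sub>R A x) D"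
  by (rule clinear_on_inj_on[OF clinear_on_implicit_map, where C = 1]) (simp add: norm_le_implicit_map)

text \<open>The backward Euler step, the inverse of I - h A. The value at h = 0 is set by hand
  because the identity on \<open>D\<close> does not reach vectors outside \<open>D\<close>.\<close>

definition J :: "real \<Rightarrow> 'a \<Rightarrow> 'a" where
  "J h f = (if h = 0 then f else THE x. x \<in> D \<and> x - h *\<^sub>R A x = f)"

lemma J_0 [simp]: "J 0 f = f"
  by (simp add: J_def)

lemma J_implicit_map:
  assumes "h \<ge> 0" "x \<in> D"
  shows "J h (x - h *\<^sub>R A x) = x"
proof (cases "h = 0")
  case False
  have "(THE y. y \<in> D \<and> y - h *\<^sub>R A y = x - h *\<^sub>R A x) = x"
  proof (rule the_equality)
    fix y assume "y \<in> D \<and> y - h *\<^sub>R A y = x - h *\<^sub>R A x"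
    then show "y = x"
      using inj_on_implicit_map[OF assms(1)] assms(2) by (auto dest: inj_onD)
  qed (use assms in simp)
  then show ?thesis
    using False by (simp add: J_def)
qed simp

lemma J_in_D: "h > 0 \<Longrightarrow> J h f \<in> D"
  and J_eq: "h > 0 \<Longrightarrow> J h f - h *\<^sub>R A (J h f) = f"
proof -
  assume h: "h > 0"
  obtain x where "x \<in> D" "x - h *\<^sub>R A x = f"
    using surj[OF h] by blast
  then show "J h f \<in> D" "J h f - h *\<^sub>R A (J h f) = f"
    using J_implicit_map[of h x] h by auto
qed

lemma J_add:
  assumes h: "h \<ge> 0"
  shows "J h (x + y) = J h x + J h y"
proof (cases "h = 0")
  case False
  with h have "h > 0"
    by simp
  note J = J_in_D[OF this] J_eq[OF this]
  have "(J h x + J h y) - h *\<^sub>R A (J h x + J h y)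
      = (J h x - h *\<^sub>R A (J h x)) + (J h y - h *\<^sub>R A (J h y))"
    by (rule clinear_on_add[OF clinear_on_implicit_map J(1) J(1)])
  also have "\<dots> = x + y"
    by (simp only: J(2))
  finally show ?thesis
    using J_implicit_map[OF h csubspace_add[OF csubspace_D J(1) J(1)]] by metis
qed simp

lemma J_scaleC:
  assumes h: "h \<ge> 0"
  shows "J h (c *\<^sub>C x) = c *\<^sub>C J h x"
proof (cases "h = 0")
  case False
  with h have "h > 0"
    by simp
  note J = J_in_D[OF this] J_eq[OF this]
  have "c *\<^sub>C J h x - h *\<^sub>R A (c *\<^sub>C J h x) = c *\<^sub>C (J h x - h *\<^sub>R A (J h x))"
    by (rule clinear_on_scaleC[OF clinear_on_implicit_map J(1)])
  also have "\<dots> = c *\<^sub>C x"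
    by (simp only: J(2))
  finally show ?thesis
    using J_implicit_map[OF h csubspace_scaleC[OF csubspace_D J(1)]] by metis
qed simp

lemma J_scaleR: "h \<ge> 0 \<Longrightarrow> J h (r *\<^sub>R x) = r *\<^sub>R J h x"
  using J_scaleC[of h "complex_of_real r" x] by (simp add: scaleC_of_real)

lemma J_diff: "h \<ge> 0 \<Longrightarrow> J h (x - y) = J h x - J h y"
  using J_add[of h x "- y"] J_scaleR[of h "- 1" y] by simp

lemma norm_J_le:
  assumes h: "h \<ge> 0"
  shows "norm (J h x) \<le> norm x"
proof (cases "h = 0")
  case False
  with h have "h > 0"
    by simp
  then show ?thesis
    using norm_le_implicit_map[OF h J_in_D[OF \<open>h > 0\<close>]] J_eq[OF \<open>h > 0\<close>] by metis
qed simp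

text \<open>For h > 0, A (J h x) is a multiple of J h x - x and thus lies in \<open>D\<close>;
  applying \<open>A\<close> to the defining equation then identifies it with J h (A x).\<close>

lemma J_preserves_D:
  assumes "h \<ge> 0" "x \<in> D"
  shows "J h x \<in> D" "A (J h x) = J h (A x)"
proof -
  have "J h x \<in> D \<and> A (J h x) = J h (A x)"
  proof (cases "h = 0")
    case False
    with assms have h: "h > 0"
      by simp
    define y where "y = J h x"
    have y: "y \<in> D" "y - h *\<^sub>R A y = x"
      using J_in_D J_eq h by (auto simp: y_def)
    have eq: "A y = (1 / h) *\<^sub>R (y - x)"
      using h by (simp add: y(2)[symmetric])
    then have Ay: "A y \<in> D"
      using y assms by (simp only: csubspace_intros[OF csubspace_D])
    have "A y - h *\<^sub>R A (A y) = A (y - h *\<^sub>R A y)"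
      using y(1) Ay by (simp add: clinear_on_simps[OF clinear_A] csubspace_intros[OF csubspace_D])
    then have "A y - h *\<^sub>R A (A y) = A x"
      by (simp add: y)
    then have "J h (A x) = A y"
      using J_implicit_map[of h "A y"] Ay h by simp
    then show ?thesis
      using y(1) by (simp add: y_def)
  qed (use assms in auto)
  then show "J h x \<in> D" "A (J h x) = J h (A x)"
    by auto
qed

lemma J_commute:
  assumes "h \<ge> 0" "k \<ge> 0"
  shows "J h (J k f) = J k (J h f)"
proof (cases "k = 0")
  case False
  with assms have k: "k > 0"
    by simp
  define g where "g = J k f"
  have g: "g \<in> D" "g - k *\<^sub>R A g = f"
    using J_in_D J_eq k by (auto simp: g_def)
  have "J h f = J h g - k *\<^sub>R A (J h g)"
    using arg_cong[OF g(2), of "J h"] g(1) assms by (simp add: J_diff J_scaleR J_preserves_D)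
  then show ?thesis
    using J_implicit_map[of k "J h g"] J_preserves_D(1)[OF _ g(1)] assms by (simp add: g_def)
qed simp

text \<open>The domain of the square of \<open>A\<close>, on which the local error of the Euler
  scheme is of second order.\<close>

definition D2 :: "'a set" where "D2 = {x \<in> D. A x \<in> D}"

lemma J_preserves_D2:
  assumes "h \<ge> 0" "x \<in> D2"
  shows "J h x \<in> D2" "A (A (J h x)) = J h (A (A x))"
  using assms J_preserves_D[of h] by (auto simp: D2_def)

text \<open>(I - s A)(I - t A) differs from I - (s + t) A exactly by s t A^2; inverting both sides
  gives the local error.\<close>

lemma J_J_diff_le:
  assumes "s \<ge> 0" "t \<ge> 0" "x \<in> D2"
  shows "norm (J s (J t x) - J (s + t) x) \<le> (s * t) * norm (A (A x))"
proof -
  define y where "y = J (s + t) x"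
  have y: "y \<in> D" "A y \<in> D" "A (A y) = J (s + t) (A (A x))"
    using J_preserves_D2[of "s + t" x] assms by (auto simp: D2_def y_def)
  have x: "y - (s + t) *\<^sub>R A y = x"
    using J_eq[of "s + t" x] assms by (cases "s + t = 0") (auto simp: y_def)
  have "J s (J t ((y - s *\<^sub>R A y) - t *\<^sub>R A (y - s *\<^sub>R A y))) = y"
    using J_implicit_map assms y by (simp add: csubspace_intros[OF csubspace_D])
  moreover have "(y - s *\<^sub>R A y) - t *\<^sub>R A (y - s *\<^sub>R A y) = x + (s * t) *\<^sub>R A (A y)"
    unfolding x[symmetric] using y
    by (simp add: clinear_on_simps[OF clinear_A] csubspace_intros[OF csubspace_D] algebra_simps)
  ultimately have "J s (J t (x + (s * t) *\<^sub>R A (A y))) = y"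
    by (simp only:)
  then have "J s (J t x) + (s * t) *\<^sub>R J s (J t (A (A y))) = y"
    using assms by (simp add: J_add J_scaleR)
  then have "J s (J t x) - y = - ((s * t) *\<^sub>R J s (J t (A (A y))))"
    by (simp add: algebra_simps)
  then have "norm (J s (J t x) - y) = (s * t) * norm (J s (J t (A (A y))))"
    using assms by simp
  also have "\<dots> \<le> (s * t) * norm (A (A x))"
  proof (rule mult_left_mono)
    have "norm (J s (J t (A (A y)))) \<le> norm (J t (A (A y)))"
      using assms by (intro norm_J_le)
    also have "\<dots> \<le> norm (A (A y))"
      using assms by (intro norm_J_le)
    also have "\<dots> \<le> norm (A (A x))"
      unfolding y(3) using assms by (intro norm_J_le) simp
    finally show "norm (J s (J t (A (A y)))) \<le> norm (A (A x))" .
  qed (use assms in simp)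
  finally show ?thesis
    by (simp add: y_def)
qed

lemma J_diff_eq:
  assumes h: "h \<ge> 0" and x: "x \<in> D"
  shows "J h x - x = h *\<^sub>R J h (A x)"
proof -
  have "J h x - h *\<^sub>R J h (A x) = x"
    using J_implicit_map[OF h x] by (simp only: J_diff[OF h] J_scaleR[OF h])
  then show ?thesis
    by (simp add: algebra_simps)
qed

lemma J_diff_le: "h \<ge> 0 \<Longrightarrow> x \<in> D \<Longrightarrow> norm (J h x - x) \<le> h * norm (A x)"
  by (simp add: J_diff_eq norm_J_le mult_left_mono)

text \<open>If \<open>z\<close> is orthogonal to \<open>D\<close>, test with J 1 z, which lies in
  \<open>D\<close>: dissipativity bounds its squared norm by its inner product with
  \<open>z\<close>, which is 0.\<close>

lemma closure_D: "closure D = UNIV"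
proof (rule dense_if_orthogonal_trivial[OF csubspace_D])
  fix z assume orth: "\<And>v. v \<in> D \<Longrightarrow> inner z v = 0"
  have J: "J 1 z \<in> D" "J 1 z - A (J 1 z) = z"
    using J_in_D[of 1 z] J_eq[of 1 z] by auto
  have "(norm (J 1 z))\<^sup>2 \<le> inner (J 1 z - A (J 1 z)) (J 1 z)"
    using dissipative[OF J(1)] by (simp add: inner_diff_left power2_norm_eq_inner)
  then have "J 1 z = 0"
    using orth[OF J(1)] J(2) by simp
  then show "z = 0"
    using J(2) clinear_on_0[OF clinear_A] by simp
qed

lemma D_approx:
  assumes "e > 0"
  obtains y where "y \<in> D" "norm (x - y) < e"
  using closure_D assms closure_approachable[of x D] by (metis UNIV_I dist_norm norm_minus_commute)

text \<open>Density of \<open>D\<close> plus uniform contractivity. It is stated abstractly because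
  it serves both the Euler steps and the limit semigroup.\<close>

lemma contractions_tendsto_id:
  fixes S :: "real \<Rightarrow> 'a \<Rightarrow> 'a"
  assumes S_diff: "\<And>h x y. h \<ge> 0 \<Longrightarrow> S h (x - y) = S h x - S h y"
    and norm_S_le: "\<And>h x. h \<ge> 0 \<Longrightarrow> norm (S h x) \<le> norm x"
    and S_diff_le: "\<And>h x. h \<ge> 0 \<Longrightarrow> x \<in> D \<Longrightarrow> norm (S h x - x) \<le> h * norm (A x)"
  shows "((\<lambda>h. S h x) \<longlongrightarrow> x) (at_right 0)"
proof (rule tendstoI)
  fix e :: real assume e: "e > 0"
  obtain y where y: "y \<in> D" "norm (x - y) < e / 3"
    using D_approx[of "e / 3" x] e by auto
  define b where "b = e / (3 * (1 + norm (A y)))"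
  have pos: "1 + norm (A y) > 0"
    by (simp add: add_pos_nonneg)
  have b: "b > 0"
    using e pos by (simp add: b_def)
  have "dist (S h x) x < e" if h: "0 < h" "h < b" for h
  proof -
    have "norm (S h x - x) = norm (S h (x - y) + (S h y - y) - (x - y))"
      using h by (simp add: S_diff)
    also have "\<dots> \<le> norm (x - y) + h * norm (A y) + norm (x - y)"
      using norm_S_le[of h "x - y"] S_diff_le[of h y] y h
      by (intro norm_add_diff_le) auto
    also have "h * norm (A y) \<le> b * (1 + norm (A y))"
      using h b by (intro mult_mono) auto
    also have "b * (1 + norm (A y)) = e / 3"
      using pos by (simp add: b_def field_simps)
    finally show ?thesis
      using y by (simp add: dist_norm)
  qed
  then show "\<forall>\<^sub>F h in at_right 0. dist (S h x) x < e"
    unfolding eventually_at_right_field using b by blast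
qed

lemma J_tendsto: "((\<lambda>h. J h x) \<longlongrightarrow> x) (at_right 0)"
  by (rule contractions_tendsto_id) (rule J_diff norm_J_le J_diff_le; assumption)+

text \<open>Two approximations in a row: by some \<open>z\<close> in \<open>D\<close>, then by J h
  z, which gains one more power of \<open>A\<close>.\<close>

lemma D2_approx:
  assumes "e > 0"
  obtains y where "y \<in> D2" "norm (x - y) < e"
proof -
  obtain z where z: "z \<in> D" "norm (x - z) < e / 2"
    using D_approx[of "e / 2" x] assms by auto
  have "\<forall>\<^sub>F h in at_right 0. dist (J h z) z < e / 2"
    using J_tendsto by (rule tendstoD) (use assms in simp)
  then obtain b where b: "b > 0" "\<And>h. 0 < h \<Longrightarrow> h < b \<Longrightarrow> dist (J h z) z < e / 2"
    unfolding eventually_at_right_field by blast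
  let ?y = "J (b / 2) z"
  have "?y \<in> D2"
    using J_in_D J_preserves_D z b by (auto simp: D2_def)
  moreover have "norm (x - ?y) < e"
    using b(2)[of "b / 2"] b(1) z(2) norm_triangle_ineq[of "x - z" "z - ?y"]
    by (simp add: dist_norm norm_minus_commute)
  ultimately show ?thesis
    using that by blast
qed

lemma closure_D2: "closure D2 = UNIV"
  unfolding closure_approachable set_eq_iff
  by (metis D2_approx UNIV_I closure_approachable dist_norm norm_minus_commute)

text \<open>
  The semigroup is the limit of the backward Euler scheme along dyadic subdivisions, which only
  requires comparing one step of length \<open>2 h\<close> with two steps of length \<open>h\<close>.
\<close>

definition V :: "nat \<Rightarrow> real \<Rightarrow> 'a \<Rightarrow> 'a" where
  "V k t = J (t / 2 ^ k) ^^ (2 ^ k)"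

lemma V_add: "t \<ge> 0 \<Longrightarrow> V k t (x + y) = V k t x + V k t y"
  and V_scaleC: "t \<ge> 0 \<Longrightarrow> V k t (c *\<^sub>C x) = c *\<^sub>C V k t x"
  and norm_V_le: "t \<ge> 0 \<Longrightarrow> norm (V k t x) \<le> norm x"
proof -
  assume t: "t \<ge> 0"
  have "(J (t / 2 ^ k) ^^ n) (x + y) = (J (t / 2 ^ k) ^^ n) x + (J (t / 2 ^ k) ^^ n) y"
    "(J (t / 2 ^ k) ^^ n) (c *\<^sub>C x) = c *\<^sub>C (J (t / 2 ^ k) ^^ n) x" for n
    by (induction n) (use t in \<open>auto simp: J_add J_scaleC\<close>)
  moreover have "norm ((J (t / 2 ^ k) ^^ n) x) \<le> norm x" for n
  proof (induction n)
    case (Suc n)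
    then show ?case
      using norm_J_le[of "t / 2 ^ k" "(J (t / 2 ^ k) ^^ n) x"] t by simp
  qed simp
  ultimately show "V k t (x + y) = V k t x + V k t y" "V k t (c *\<^sub>C x) = c *\<^sub>C V k t x"
    "norm (V k t x) \<le> norm x"
    by (auto simp: V_def)
qed

lemma V_diff: "t \<ge> 0 \<Longrightarrow> V k t (x - y) = V k t x - V k t y"
  using V_add[of t k x "- y"] V_scaleC[of t k "- 1" y] by simp

text \<open>There are 2^k comparisons with local error h^2, where h = t / 2^(k+1); the product is
  t^2 / (4 * 2^k).\<close>

lemma V_Suc_diff_le:
  assumes t: "t \<ge> 0" and x: "x \<in> D2"
  shows "norm (V (Suc k) t x - V k t x) \<le> t\<^sup>2 / 4 * (1 / 2) ^ k * norm (A (A x))"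
proof -
  define h where "h = t / 2 ^ Suc k"
  have h: "h \<ge> 0" "h + h = t / 2 ^ k"
    using t by (auto simp: h_def)
  have "J h \<circ> J h = J h ^^ 2"
    by (simp add: numeral_2_eq_2)
  then have "V (Suc k) t = (J h \<circ> J h) ^^ (2 ^ k)"
    by (simp only: V_def h_def funpow_mult power_Suc)
  moreover have "V k t = J (h + h) ^^ (2 ^ k)"
    using h by (simp add: V_def)
  moreover have "norm (((J h \<circ> J h) ^^ (2 ^ k)) x - (J (h + h) ^^ (2 ^ k)) x)
      \<le> real (2 ^ k) * ((h * h) * norm (A (A x)))"
  proof (rule funpow_diff_le[where E = D2])
    show "norm ((J h \<circ> J h) y) \<le> norm y" for y
      using norm_J_le[OF h(1), of y] norm_J_le[OF h(1), of "J h y"] by simp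
    show "J (h + h) y \<in> D2 \<and> norm (A (A (J (h + h) y))) \<le> norm (A (A y))" if "y \<in> D2" for y
      using J_preserves_D2[of "h + h" y] norm_J_le[of "h + h"] that h(1) by simp
    show "norm ((J h \<circ> J h) y - J (h + h) y) \<le> (h * h) * norm (A (A y))" if "y \<in> D2" for y
      using J_J_diff_le[OF h(1) h(1) that] by simp
  qed (use h x in \<open>auto simp: J_diff\<close>)
  moreover have "real (2 ^ k) * ((h * h) * norm (A (A x))) = t\<^sup>2 / 4 * (1 / 2) ^ k * norm (A (A x))"
    by (simp add: h_def power2_eq_square power_one_over field_simps)
  ultimately show ?thesis
    by (simp only:)
qed

lemma V_diff_le:
  assumes t: "t \<ge> 0" and x: "x \<in> D2" and "k \<le> n"
  shows "norm (V n t x - V k t x) \<le> t\<^sup>2 / 2 * (1 / 2) ^ k * norm (A (A x))"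
proof -
  let ?N = "norm (A (A x))"
  \<comment> \<open>The sharper geometric difference is what closes the induction: t^2/4 * (1/2)^n
    is t^2/2 times (1/2)^n - (1/2)^(n+1).\<close>
  have "norm (V n t x - V k t x) \<le> t\<^sup>2 / 2 * ((1 / 2) ^ k - (1 / 2) ^ n) * ?N"
    using \<open>k \<le> n\<close>
  proof (induction n rule: dec_induct)
    case (step n)
    have "norm (V (Suc n) t x - V k t x)
        \<le> t\<^sup>2 / 4 * (1 / 2) ^ n * ?N + t\<^sup>2 / 2 * ((1 / 2) ^ k - (1 / 2) ^ n) * ?N"
      using step V_Suc_diff_le[OF t x, of n] by (intro norm_diff_triangle_le)
    then show ?case
      by (simp add: algebra_simps)
  qed simp
  also have "\<dots> \<le> t\<^sup>2 / 2 * (1 / 2) ^ k * ?N"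
    by (intro mult_right_mono mult_left_mono) auto
  finally show ?thesis .
qed

lemma V_convergent:
  assumes t: "t \<ge> 0"
  shows "convergent (\<lambda>k. V k t x)"
proof (rule Cauchy_convergent, unfold Cauchy_altdef2, intro allI impI)
  fix e :: real assume e: "e > 0"
  obtain y where y: "y \<in> D2" "norm (x - y) < e / 3"
    using D2_approx[of "e / 3" x] e by auto
  have "(\<lambda>k. t\<^sup>2 / 2 * (1 / 2) ^ k * norm (A (A y))) \<longlonglongrightarrow> t\<^sup>2 / 2 * 0 * norm (A (A y))"
    by (intro tendsto_intros LIMSEQ_realpow_zero) auto
  then have "\<forall>\<^sub>F k in sequentially. t\<^sup>2 / 2 * (1 / 2) ^ k * norm (A (A y)) < e / 3"
    by (rule order_tendstoD) (use e in simp)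
  then obtain k where k: "t\<^sup>2 / 2 * (1 / 2) ^ k * norm (A (A y)) < e / 3"
    by (auto simp: eventually_sequentially)
  have "dist (V n t x) (V k t x) < e" if "n \<ge> k" for n
  proof -
    have "norm (V n t x - V k t x) = norm (V n t (x - y) + (V n t y - V k t y) - V k t (x - y))"
      using t by (simp add: V_diff)
    also have "\<dots> \<le> norm (x - y) + t\<^sup>2 / 2 * (1 / 2) ^ k * norm (A (A y)) + norm (x - y)"
      using norm_V_le[OF t, of _ "x - y"] V_diff_le[OF t y(1) that]
      by (intro norm_add_diff_le) auto
    finally show ?thesis
      using k y by (simp add: dist_norm)
  qed
  then show "\<exists>k. \<forall>n\<ge>k. dist (V n t x) (V k t x) < e"
    by blast
qed

section \<open>The limit semigroup and its generator\<close>

definition T :: "real \<Rightarrow> 'a \<Rightarrow> 'a" where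
  "T t x = lim (\<lambda>k. V k t x)"

lemma V_tendsto: "t \<ge> 0 \<Longrightarrow> (\<lambda>k. V k t x) \<longlonglongrightarrow> T t x"
  unfolding T_def using V_convergent by (rule convergent_LIMSEQ_iff[THEN iffD1])

lemma T_add: "t \<ge> 0 \<Longrightarrow> T t (x + y) = T t x + T t y"
  by (rule LIMSEQ_unique[OF V_tendsto]) (auto simp: V_add intro!: tendsto_intros V_tendsto)

lemma norm_T_le: "t \<ge> 0 \<Longrightarrow> norm (T t x) \<le> norm x"
  by (rule LIMSEQ_le_const2[OF tendsto_norm[OF V_tendsto]]) (auto simp: norm_V_le)

lemma T_scaleC:
  assumes t: "t \<ge> 0"
  shows "T t (c *\<^sub>C x) = c *\<^sub>C T t x"
proof (rule LIMSEQ_unique[OF V_tendsto[OF t]])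
  have "bounded_linear (\<lambda>y::'a. c *\<^sub>C y)"
    by (rule bounded_linear_intro[of _ "cmod c"])
      (simp_all add: scaleC_add_right scaleC_scaleR norm_scaleC mult.commute)
  then have "(\<lambda>k. c *\<^sub>C V k t x) \<longlonglongrightarrow> c *\<^sub>C T t x"
    by (rule bounded_linear.tendsto) (rule V_tendsto[OF t])
  then show "(\<lambda>k. V k t (c *\<^sub>C x)) \<longlonglongrightarrow> c *\<^sub>C T t x"
    by (simp add: V_scaleC[OF t])
qed

lemma T_bounded_clinear: "t \<ge> 0 \<Longrightarrow> bounded_clinear (T t)"
  by (rule bounded_clinearI[of _ 1]) (auto simp: T_add T_scaleC norm_T_le)

lemma T_bounded_linear: "t \<ge> 0 \<Longrightarrow> bounded_linear (T t)"
  using T_bounded_clinear by (simp add: bounded_clinear_def)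

lemma T_diff: "t \<ge> 0 \<Longrightarrow> T t (x - y) = T t x - T t y"
  using T_bounded_linear by (simp add: bounded_linear.linear linear_diff)

lemma T_0: "T 0 = id"
proof
  fix x :: 'a
  have "((\<lambda>y. y) ^^ n) x = x" for n
    by (induction n) auto
  moreover have "J 0 = (\<lambda>y. y)"
    by auto
  ultimately have "V k 0 x = x" for k
    by (simp add: V_def)
  then show "T 0 x = id x"
    using V_tendsto[of 0 x] LIMSEQ_const_iff[of x "T 0 x"] by simp
qed

text \<open>At a fixed level \<open>k\<close>, steps of lengths s / 2^k and t / 2^k commute and can
  be paired, so they compare directly with steps of length (s + t) / 2^k. The total error is s t /
  2^k, and \<open>s\<close> and \<open>t\<close> need not be commensurable.\<close>

lemma T_semigroup:
  assumes s: "s \<ge> 0" and t: "t \<ge> 0"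
  shows "T (s + t) = T s \<circ> T t"
proof -
  have on_D2: "T (s + t) x = T s (T t x)" if x: "x \<in> D2" for x
  proof -
    let ?N = "norm (A (A x))"
    have bound: "norm (V k s (V k t x) - V k (s + t) x) \<le> s * t * (1 / 2) ^ k * ?N" for k
    proof -
      define a b where "a = s / 2 ^ k" and "b = t / 2 ^ k"
      have ab: "a \<ge> 0" "b \<ge> 0"
        using s t by (auto simp: a_def b_def)
      have "norm (((J a \<circ> J b) ^^ (2 ^ k)) x - (J (a + b) ^^ (2 ^ k)) x) \<le> real (2 ^ k) * ((a * b) * ?N)"
      proof (rule funpow_diff_le[where E = D2])
        show "norm ((J a \<circ> J b) y) \<le> norm y" for y
          using norm_J_le[OF ab(2), of y] norm_J_le[OF ab(1), of "J b y"] by simp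
        show "J (a + b) y \<in> D2 \<and> norm (A (A (J (a + b) y))) \<le> norm (A (A y))" if "y \<in> D2" for y
          using J_preserves_D2[of "a + b" y] norm_J_le[of "a + b"] that ab by simp
        show "norm ((J a \<circ> J b) y - J (a + b) y) \<le> (a * b) * norm (A (A y))" if "y \<in> D2" for y
          using J_J_diff_le[OF ab that] by simp
      qed (use ab x in \<open>auto simp: J_diff\<close>)
      moreover have "((J a \<circ> J b) ^^ (2 ^ k)) x = V k s (V k t x)"
        using J_commute[OF ab] by (subst funpow_commute_comp) (auto simp: V_def a_def b_def)
      moreover have "J (a + b) ^^ (2 ^ k) = V k (s + t)"
        by (simp add: V_def a_def b_def add_divide_distrib)
      moreover have "real (2 ^ k) * ((a * b) * ?N) = s * t * (1 / 2) ^ k * ?N"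
        by (simp add: a_def b_def power_one_over field_simps)
      ultimately show ?thesis
        by (simp only:)
    qed
    have "(\<lambda>k. V k s (V k t x) - V k (s + t) x) \<longlonglongrightarrow> 0"
    proof (rule Lim_null_comparison)
      have "(\<lambda>k. s * t * (1 / 2) ^ k * ?N) \<longlonglongrightarrow> s * t * 0 * ?N"
        by (intro tendsto_intros LIMSEQ_realpow_zero) auto
      then show "(\<lambda>k. s * t * (1 / 2) ^ k * ?N) \<longlonglongrightarrow> 0"
        by simp
    qed (use bound in simp)
    moreover have "(\<lambda>k. V k s (V k t x - T t x)) \<longlonglongrightarrow> 0"
    proof (rule Lim_null_comparison)
      show "(\<lambda>k. norm (V k t x - T t x)) \<longlonglongrightarrow> 0"
        using V_tendsto[OF t, of x] by (simp add: tendsto_norm_zero_iff LIM_zero)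
    qed (use norm_V_le[OF s] in simp)
    \<comment> \<open>The left-hand side is \<open>V k (s + t) x\<close> rearranged into three terms
      with known limits; the middle one vanishes because \<open>V k s\<close> is a contraction for
      every \<open>k\<close>.\<close>
    ultimately have "(\<lambda>k. V k s (T t x) + V k s (V k t x - T t x)
        - (V k s (V k t x) - V k (s + t) x)) \<longlonglongrightarrow> T s (T t x) + 0 - 0"
      by (intro tendsto_intros V_tendsto s)
    then have "(\<lambda>k. V k (s + t) x) \<longlonglongrightarrow> T s (T t x)"
      using s by (simp add: V_diff)
    then show ?thesis
      using V_tendsto[of "s + t" x] s t LIMSEQ_unique by simp
  qed
  have cont: "continuous_on UNIV (T r)" if "r \<ge> 0" for r
    using bounded_linear.continuous_on[OF T_bounded_linear[OF that] continuous_on_id] by simp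
  have "continuous_on UNIV (\<lambda>x. T s (T t x))"
    using continuous_on_compose2[OF cont[OF s] cont[OF t]] by simp
  then have "closed {x. T (s + t) x = T s (T t x)}"
    using cont[of "s + t"] s t by (intro closed_Collect_eq) auto
  then have "closure D2 \<subseteq> {x. T (s + t) x = T s (T t x)}"
    by (intro closure_minimal) (auto simp: on_D2)
  then show ?thesis
    unfolding closure_D2 by (auto simp: fun_eq_iff)
qed

lemma T_diff_le:
  assumes t: "t \<ge> 0" and x: "x \<in> D"
  shows "norm (T t x - x) \<le> t * norm (A x)"
proof (rule LIMSEQ_le_const2)
  show "(\<lambda>k. norm (V k t x - x)) \<longlonglongrightarrow> norm (T t x - x)"
    by (intro tendsto_intros V_tendsto t)
  have "norm (V k t x - x) \<le> t * norm (A x)" for k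
  proof -
    define h where "h = t / 2 ^ k"
    have h: "h \<ge> 0"
      using t by (simp add: h_def)
    \<comment> \<open>Comparison of the Euler scheme with the scheme that stays at
      \<open>x\<close>.\<close>
    have "norm ((J h ^^ (2 ^ k)) x - (id ^^ (2 ^ k)) x) \<le> real (2 ^ k) * (h * norm (A x))"
      by (rule funpow_diff_le[where E = "{x}" and N = "\<lambda>y. norm (A y)"])
        (use J_diff_le[OF h x] norm_J_le[OF h] J_diff[OF h] h in auto)
    then show ?thesis
      by (simp add: V_def h_def)
  qed
  then show "\<exists>N. \<forall>k\<ge>N. norm (V k t x - x) \<le> t * norm (A x)"
    by blast
qed

lemma T_tendsto: "((\<lambda>t. T t x) \<longlongrightarrow> x) (at_right 0)"
  by (rule contractions_tendsto_id) (rule T_diff norm_T_le T_diff_le; assumption)+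

lemma T_C0_semigroup: "C0_semigroup T"
  unfolding C0_semigroup_def
  using T_bounded_clinear T_0 T_semigroup T_tendsto by blast

text \<open>A single Euler step is level 0 of the scheme, so it approximates T t x to second order;
  its own expansion is explicit.\<close>

lemma T_first_order:
  assumes t: "t \<ge> 0" and x: "x \<in> D2"
  shows "norm (T t x - x - t *\<^sub>R A x) \<le> 2 * t\<^sup>2 * norm (A (A x))"
proof -
  let ?N = "norm (A (A x))"
  have "norm (T t x - V 0 t x) \<le> t\<^sup>2 / 2 * ?N"
  proof (rule LIMSEQ_le_const2)
    show "(\<lambda>k. norm (V k t x - V 0 t x)) \<longlonglongrightarrow> norm (T t x - V 0 t x)"
      by (intro tendsto_intros V_tendsto t)
  qed (use V_diff_le[OF t x, of 0] in auto)
  then have 1: "norm (T t x - J t x) \<le> t\<^sup>2 / 2 * ?N"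
    by (simp add: V_def)
  have xD: "x \<in> D" "A x \<in> D"
    using x by (auto simp: D2_def)
  have "J t x - x = t *\<^sub>R J t (A x)"
    by (rule J_diff_eq[OF t xD(1)])
  then have "norm (J t x - x - t *\<^sub>R A x) = t * norm (J t (A x) - A x)"
    using t by (simp add: scaleR_diff_right[symmetric])
  also have "\<dots> \<le> t * (t * ?N)"
    using J_diff_le[OF t xD(2)] t by (intro mult_left_mono)
  finally have 2: "norm (J t x - x - t *\<^sub>R A x) \<le> t\<^sup>2 * ?N"
    by (simp add: power2_eq_square)
  have "norm (T t x - x - t *\<^sub>R A x) \<le> norm (T t x - J t x) + norm (J t x - x - t *\<^sub>R A x)"
    using norm_triangle_ineq[of "T t x - J t x" "J t x - x - t *\<^sub>R A x"]
    by (simp add: algebra_simps)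
  also have "\<dots> \<le> t\<^sup>2 / 2 * ?N + t\<^sup>2 * ?N"
    using 1 2 by (rule add_mono)
  also have "\<dots> \<le> 2 * t\<^sup>2 * ?N"
    by (simp add: field_simps)
  finally show ?thesis .
qed

text \<open>For \<open>x\<close> in \<open>D\<close> only, A x need not lie in \<open>D\<close>, so
  the second order estimate is applied to y = J h x. This is close in the graph norm because A y = J
  h (A x), and the remainder x - y costs only t times the norm of A (x - y).\<close>

lemma T_right_derivative:
  assumes x: "x \<in> D"
  shows "((\<lambda>t. (T t x - x) /\<^sub>R t) \<longlongrightarrow> A x) (at_right 0)"
proof (rule tendstoI)
  fix e :: real assume e: "e > 0"
  have "\<forall>\<^sub>F h in at_right 0. dist (J h (A x)) (A x) < e / 4"
    using J_tendsto by (rule tendstoD) (use e in simp)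
  then obtain h where h: "h > 0" "dist (J h (A x)) (A x) < e / 4"
    unfolding eventually_at_right_field by (meson dense)
  define y where "y = J h x"
  have y: "y \<in> D" "A y = J h (A x)" "y \<in> D2"
    using J_preserves_D[of h x] J_in_D[of h] h x by (auto simp: y_def D2_def)
  have xy: "norm (A x - A y) < e / 4"
    using h y by (simp add: dist_norm norm_minus_commute)
  define b where "b = e / (4 * (1 + norm (A (A y))))"
  have pos: "1 + norm (A (A y)) > 0"
    by (simp add: add_pos_nonneg)
  have b: "b > 0"
    using e pos by (simp add: b_def)
  have "dist ((T t x - x) /\<^sub>R t) (A x) < e" if t: "0 < t" "t < b" for t
  proof -
    have "norm (T t x - x - t *\<^sub>R A x)
        = norm ((T t (x - y) - (x - y)) + (T t y - y - t *\<^sub>R A y) + t *\<^sub>R (A y - A x))"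
      using t by (simp add: T_diff scaleR_diff_right)
    also have "\<dots> \<le> t * norm (A (x - y)) + 2 * t\<^sup>2 * norm (A (A y)) + t * norm (A y - A x)"
      using T_diff_le[of t "x - y"] T_first_order[OF _ y(3), of t] t x y
      by (intro norm_triangle_mono) (auto simp: csubspace_diff[OF csubspace_D])
    also have "\<dots> = t * (2 * norm (A x - A y) + 2 * (t * norm (A (A y))))"
      using x y by (simp add: clinear_on_simps[OF clinear_A] norm_minus_commute power2_eq_square algebra_simps)
    also have "t * norm (A (A y)) \<le> b * (1 + norm (A (A y)))"
      using t b by (intro mult_mono) auto
    also have "b * (1 + norm (A (A y))) = e / 4"
      using pos by (simp add: b_def field_simps)
    also have "t * (2 * norm (A x - A y) + 2 * (e / 4)) < t * e"
      using t xy by (intro mult_strict_left_mono) auto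
    finally have "norm (T t x - x - t *\<^sub>R A x) < t * e"
      using t by (simp add: mult_left_mono)
    moreover have "(T t x - x) /\<^sub>R t - A x = (T t x - x - t *\<^sub>R A x) /\<^sub>R t"
      using t by (simp add: scaleR_diff_right)
    ultimately show ?thesis
      using t by (simp add: dist_norm divide_inverse[symmetric] pos_divide_less_eq mult.commute)
        (simp add: field_simps)
  qed
  then show "\<forall>\<^sub>F t in at_right 0. dist ((T t x - x) /\<^sub>R t) (A x) < e"
    unfolding eventually_at_right_field using b by blast
qed

text \<open>
  The generator of \<open>T\<close> is a dissipative extension of \<open>A\<close>, and \<open>A\<close> has no proper
  dissipative extension because \<open>I - A\<close> is onto.
\<close>

lemma T_is_generator: "is_generator T D A"
  unfolding is_generator_def
proof (intro conjI ballI set_eqI iffI)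
  fix x assume "x \<in> {x. \<exists>y. ((\<lambda>h. (T h x - x) /\<^sub>R h) \<longlongrightarrow> y) (at_right 0)}"
  then obtain y where y: "((\<lambda>h. (T h x - x) /\<^sub>R h) \<longlongrightarrow> y) (at_right 0)"
    by blast
  \<comment> \<open>With B the generator of \<open>T\<close> and y = B x, this choice makes z = x -
    w satisfy B z = z; dissipativity of B then forces z = 0.\<close>
  define w where "w = J 1 (x - y)"
  have w: "w \<in> D" "w - A w = x - y"
    using J_in_D[of 1] J_eq[of 1] by (auto simp: w_def)
  define z where "z = x - w"
  have "((\<lambda>h. (T h x - x) /\<^sub>R h - (T h w - w) /\<^sub>R h) \<longlongrightarrow> y - A w) (at_right 0)"
    by (intro tendsto_intros y T_right_derivative w)
  moreover have "y - A w = z"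
    using w(2) by (simp add: z_def algebra_simps)
  ultimately have "((\<lambda>h. inner ((T h x - x) /\<^sub>R h - (T h w - w) /\<^sub>R h) z) \<longlongrightarrow> inner z z) (at_right 0)"
    by (intro tendsto_intros) simp
  moreover have "inner ((T h x - x) /\<^sub>R h - (T h w - w) /\<^sub>R h) z \<le> 0" if h: "h > 0" for h
  proof -
    have "(T h x - x) /\<^sub>R h - (T h w - w) /\<^sub>R h = (T h z - z) /\<^sub>R h"
      using h by (simp add: z_def T_diff algebra_simps)
    moreover have "inner (T h z - z) z \<le> 0"
    proof -
      have "inner (T h z) z \<le> norm (T h z) * norm z"
        by (rule norm_cauchy_schwarz)
      also have "\<dots> \<le> norm z * norm z"
        using norm_T_le h by (intro mult_right_mono) auto
      finally show ?thesis
        by (simp add: inner_diff_left power2_norm_eq_inner[symmetric] power2_eq_square)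
    qed
    ultimately show ?thesis
      using h by (simp add: mult_le_0_iff)
  qed
  ultimately have "inner z z \<le> 0"
    by (intro tendsto_upperbound[of _ "inner z z" "at_right 0"])
      (auto simp: eventually_at_right_field intro!: exI[of _ 1])
  then have "z = 0"
    using inner_ge_zero[of z] inner_eq_zero_iff[of z] by linarith
  then have "x = w"
    by (simp add: z_def)
  then show "x \<in> D"
    using w by simp
qed (auto intro: T_right_derivative)

lemma generates: "generates_contraction_semigroup D A"
  unfolding generates_contraction_semigroup_def
  using T_C0_semigroup T_is_generator norm_T_le
  by (intro exI[of _ T] conjI allI impI onorm_bound) auto

end

section \<open>Impedance passive boundary nodes\<close>

lemma dissipative_bound:
  fixes A :: "'a::complex_inner \<Rightarrow> 'a"
  assumes "inner (A x) x \<le> 0"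
  shows "Re \<mu> * norm x \<le> norm (\<mu> *\<^sub>C x - A x)"
proof (cases "x = 0")
  case False
  have "Re \<mu> * (norm x)\<^sup>2 \<le> inner (\<mu> *\<^sub>C x - A x) x"
    using assms by (simp add: inner_diff_left inner_scaleC_self)
  also have "\<dots> \<le> norm (\<mu> *\<^sub>C x - A x) * norm x"
    by (rule norm_cauchy_schwarz)
  finally show ?thesis
    using False by (simp add: power2_eq_square)
qed simp

lemma inner_le_norm_add: "inner a b \<le> (norm (a + b))\<^sup>2 / 4" for a b :: "'a::real_inner"
  using inner_ge_zero[of "a - b"]
  by (simp add: power2_norm_eq_inner inner_add_left inner_add_right inner_diff_left inner_diff_right
      inner_commute)

text \<open>Turns passivity, a sign of the inner product of G x and K x, into contractivity of the
  passage from G + K to G - K.\<close>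

lemma norm_diff_eq_norm_add: "(norm (a - b))\<^sup>2 = (norm (a + b))\<^sup>2 - 4 * inner a b"
  for a b :: "'a::real_inner"
  by (simp add: power2_norm_eq_inner inner_add_left inner_add_right inner_diff_left inner_diff_right
      inner_commute)

text \<open>Lift the boundary value to any \<open>g\<close> in the domain and correct the defect of
  \<open>g\<close> by the resolvent on the kernel of \<open>G\<close>.\<close>

lemma boundary_problem_surj:
  fixes L :: "'x::chilbert_space \<Rightarrow> 'x" and G :: "'x \<Rightarrow> 'u::chilbert_space"
  assumes L: "clinear_on D L" and G: "clinear_on D G"
    and onto: "\<And>u. \<exists>x\<in>D. G x = u" and \<mu>: "\<mu> \<in> resolvent_set (ker_on D G) L"
  shows "\<exists>x\<in>D. \<mu> *\<^sub>C x - L x = y \<and> G x = u"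
proof -
  note D = clinear_on_csubspace[OF L]
  note F = clinear_on_resolvent_map[OF L, of \<mu>]
  obtain g where g: "g \<in> D" "G g = u"
    using onto by blast
  obtain x where x: "x \<in> D" "G x = 0" "\<mu> *\<^sub>C x - L x = y - (\<mu> *\<^sub>C g - L g)"
    using resolvent_setD(1)[OF \<mu>, of "y - (\<mu> *\<^sub>C g - L g)"] by (auto simp: ker_on_def)
  have "\<mu> *\<^sub>C (x + g) - L (x + g) = y"
    using clinear_on_add[OF F x(1) g(1)] x(3) by simp
  then show ?thesis
    using x g by (intro bexI[of _ "x + g"]) (auto simp: clinear_on_add[OF G] csubspace_add[OF D])
qed

locale passive_node =
  fixes D :: "'x::chilbert_space set" and G :: "'x \<Rightarrow> 'u::chilbert_space"
    and L :: "'x \<Rightarrow> 'x" and K :: "'x \<Rightarrow> 'u"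
  assumes node: "boundary_node D G L K" and passivity: "impedance_passive D G L K"
begin

lemma clinear_L: "clinear_on D L" and clinear_G: "clinear_on D G" and clinear_K: "clinear_on D K"
  using node by (auto simp: boundary_node_def bounded_from_domain_def)

lemmas csubspace_D = clinear_on_csubspace[OF clinear_L]

lemmas node_simps = clinear_on_simps[OF clinear_G] clinear_on_simps[OF clinear_K] csubspace_intros[OF csubspace_D]

lemma resolvent_map_diff:
  "x \<in> D \<Longrightarrow> y \<in> D \<Longrightarrow> \<mu> *\<^sub>C (x - y) - L (x - y) = (\<mu> *\<^sub>C x - L x) - (\<mu> *\<^sub>C y - L y)"
  by (rule clinear_on_diff[OF clinear_on_resolvent_map[OF clinear_L]])

lemma resolvent_map_add:
  "x \<in> D \<Longrightarrow> y \<in> D \<Longrightarrow> \<mu> *\<^sub>C (x + y) - L (x + y) = (\<mu> *\<^sub>C x - L x) + (\<mu> *\<^sub>C y - L y)"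
  by (rule clinear_on_add[OF clinear_on_resolvent_map[OF clinear_L]])

lemma passive_inner: "x \<in> D \<Longrightarrow> inner (L x) x \<le> inner (G x) (K x)"
  using passivity by (simp add: impedance_passive_def Re_cinner)

text \<open>For Re \<mu> \<ge> 0 this is positivity of the transfer function; for Re \<mu> > 0 it
  also bounds the state by the boundary data.\<close>

lemma inner_GK_ge:
  assumes "x \<in> D" "\<mu> *\<^sub>C x - L x = 0"
  shows "Re \<mu> * (norm x)\<^sup>2 \<le> inner (G x) (K x)"
proof -
  have "L x = \<mu> *\<^sub>C x"
    using assms(2) by simp
  then show ?thesis
    using passive_inner[OF assms(1)] by (simp add: inner_scaleC_self)
qed

lemma right_inverse:
  obtains H c where "\<And>u. H u \<in> D" "\<And>u. G (H u) = u"
    "\<And>u. norm (H u) \<le> c * norm u" "\<And>u. norm (L (H u)) \<le> c * norm u"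
proof -
  obtain H c where H: "range H \<subseteq> D" "\<And>u. G (H u) = u" "\<And>u. graph_norm L (H u) \<le> c * norm u"
    using node by (auto simp: boundary_node_def bounded_into_domain_def)
  show ?thesis
  proof (rule that[of H c])
    show "norm (H u) \<le> c * norm u" "norm (L (H u)) \<le> c * norm u" for u
      using H(3)[of u] norm_fst_le[of "H u" "L (H u)"] norm_snd_le[of "L (H u)" "H u"]
      unfolding graph_norm_def by linarith+
  qed (use H in auto)
qed

lemma G_onto: "\<exists>x\<in>D. G x = u"
  using right_inverse by metis

lemma K_bounded:
  obtains k where "k \<ge> 0" "\<And>x. x \<in> D \<Longrightarrow> norm (K x) \<le> k * (norm x + norm (L x))"
proof -
  obtain k where k: "\<And>x. x \<in> D \<Longrightarrow> norm (K x) \<le> k * graph_norm L x"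
    using node by (auto simp: boundary_node_def bounded_from_domain_def)
  show ?thesis
  proof (rule that[of "max k 0"])
    fix x assume "x \<in> D"
    then have "norm (K x) \<le> max k 0 * graph_norm L x"
      using k[of x] mult_right_mono[of k "max k 0" "graph_norm L x"] by (simp add: graph_norm_def)
    also have "\<dots> \<le> max k 0 * (norm x + norm (L x))"
      unfolding graph_norm_def by (intro mult_left_mono norm_Pair_le) auto
    finally show "norm (K x) \<le> max k 0 * (norm x + norm (L x))" .
  qed auto
qed

lemma ker_bound: "x \<in> ker_on D G \<Longrightarrow> Re \<mu> * norm x \<le> norm (\<mu> *\<^sub>C x - L x)"
  using passive_inner[of x] by (intro dissipative_bound) (auto simp: ker_on_def)

lemma clinear_L_ker: "clinear_on (ker_on D G) L"
  using clinear_L csubspace_ker_on[OF clinear_G] by (rule clinear_on_subset) (auto simp: ker_on_def)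

text \<open>Dissipativity gives the resolvent bound 1 / l at a large real \<open>l\<close>, so one
  perturbation covers the disc of radius \<open>l\<close> around \<open>l\<close>. These discs
  exhaust the open right half-plane.\<close>

lemma right_half_plane_resolvent:
  assumes \<mu>: "Re \<mu> > 0"
  shows "\<mu> \<in> resolvent_set (ker_on D G) L"
proof (rule resolvent_setI[OF clinear_L_ker])
  obtain T where "C0_semigroup T" "is_generator T (ker_on D G) L"
    using node by (auto simp: boundary_node_def generates_C0_semigroup_def)
  then obtain l0 where l0: "l0 > 0" "\<And>l f. l \<ge> l0 \<Longrightarrow> \<exists>x\<in>ker_on D G. l *\<^sub>R x - L x = f"
    using generator_surj by blast
  \<comment> \<open>The second entry gives |l - \<mu>|^2 \<le> l^2 - l Re \<mu> < l^2.\<close>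
  define l where "l = max l0 ((cmod \<mu>)\<^sup>2 / Re \<mu>)"
  have l: "l > 0" "l \<ge> l0"
    using l0 by (auto simp: l_def)
  have "(cmod \<mu>)\<^sup>2 \<le> l * Re \<mu>"
    using \<mu> by (simp add: l_def pos_divide_le_eq[symmetric])
  moreover have "0 < l * Re \<mu>"
    using l \<mu> by simp
  moreover have "(cmod (of_real l - \<mu>))\<^sup>2 = l\<^sup>2 - 2 * (l * Re \<mu>) + (cmod \<mu>)\<^sup>2"
    unfolding cmod_power2 by (simp add: power2_eq_square algebra_simps)
  ultimately have "(cmod (of_real l - \<mu>))\<^sup>2 < l\<^sup>2"
    by linarith
  then have dist: "cmod (of_real l - \<mu>) < l"
    using l by (simp add: power_less_imp_less_base)
  show "\<exists>x\<in>ker_on D G. \<mu> *\<^sub>C x - L x = f" for f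
  proof (rule resolvent_perturb[OF clinear_L_ker, of "of_real l" "1 / l"])
    show "\<exists>x\<in>ker_on D G. of_real l *\<^sub>C x - L x = f" for f
      using l0(2)[OF l(2)] by (simp add: scaleC_of_real)
    show "norm x \<le> 1 / l * norm (of_real l *\<^sub>C x - L x)" if "x \<in> ker_on D G" for x
      using ker_bound[OF that, of "of_real l"] l by (simp add: field_simps)
  qed (use dist l in simp)
  show "norm x \<le> 1 / Re \<mu> * norm (\<mu> *\<^sub>C x - L x)" if "x \<in> ker_on D G" for x
    using ker_bound[OF that, of \<mu>] \<mu> by (simp add: field_simps)
qed

lemma solve_boundary_problem:
  assumes "\<mu> \<in> resolvent_set (ker_on D G) L"
  obtains x where "x \<in> D" "\<mu> *\<^sub>C x - L x = y" "G x = u"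
  using boundary_problem_surj[OF clinear_L clinear_G G_onto assms] by blast

text \<open>Two candidates for the described solution differ by an element of the kernel of
  \<open>G\<close> annihilated by \<mu> - L, hence coincide.\<close>

lemma transfer_function_eq:
  assumes \<mu>: "\<mu> \<in> resolvent_set (ker_on D G) L" and h: "h \<in> D" "\<mu> *\<^sub>C h - L h = 0"
  shows "transfer_function D G L K \<mu> (G h) = K h"
proof -
  have "(THE x. x \<in> D \<and> \<mu> *\<^sub>C x - L x = 0 \<and> G x = G h) = h"
  proof (rule the_equality)
    fix x assume x: "x \<in> D \<and> \<mu> *\<^sub>C x - L x = 0 \<and> G x = G h"
    then have "x - h \<in> ker_on D G"
      using h by (auto simp: ker_on_def node_simps)
    moreover have "\<mu> *\<^sub>C (x - h) - L (x - h) = 0"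
      using x h by (metis resolvent_map_diff diff_self)
    ultimately have "norm (x - h) \<le> 0"
      using resolvent_setD(2)[OF \<mu>, of "x - h"] by simp
    then show "x = h"
      by simp
  qed (use h in auto)
  then show ?thesis
    by (simp add: transfer_function_def)
qed

text \<open>Needed for the Lax-Milgram argument, and to make \<open>onorm\<close> an actual bound on
  the transfer function. The solution is the bounded lift \<open>H u\<close> plus a resolvent
  correction.\<close>

lemma transfer_function_bounded_linear:
  assumes \<mu>: "\<mu> \<in> resolvent_set (ker_on D G) L"
  shows "bounded_linear (transfer_function D G L K \<mu>)"
proof -
  let ?P = "transfer_function D G L K \<mu>"
  have "\<forall>u. \<exists>x. x \<in> D \<and> \<mu> *\<^sub>C x - L x = 0 \<and> G x = u"
    by (intro allI) (rule solve_boundary_problem[OF \<mu>], blast)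
  then obtain h where h: "\<And>u. h u \<in> D" "\<And>u. \<mu> *\<^sub>C h u - L (h u) = 0" "\<And>u. G (h u) = u"
    by metis
  have P: "?P u = K (h u)" for u
    using transfer_function_eq[OF \<mu> h(1,2), of u] by (simp only: h(3))
  obtain H c where H: "\<And>u. H u \<in> D" "\<And>u. G (H u) = u"
    and c: "\<And>u. norm (H u) \<le> c * norm u" "\<And>u. norm (L (H u)) \<le> c * norm u"
    using right_inverse by blast
  obtain k where k: "k \<ge> 0" "\<And>x. x \<in> D \<Longrightarrow> norm (K x) \<le> k * (norm x + norm (L x))"
    using K_bounded by blast
  define C where "C = onorm (resolvent (ker_on D G) L \<mu>)"
  have C: "C \<ge> 0"
    using \<mu> unfolding C_def by (intro onorm_pos_le) (simp add: resolvent_set_def bounded_clinear_def)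
  define b where "b = C * (cmod \<mu> * c + c) + c"
  have hb: "norm (h u) \<le> b * norm u" for u
  proof -
    have "h u - H u \<in> ker_on D G"
      using h H by (auto simp: ker_on_def node_simps)
    then have "norm (h u - H u) \<le> C * norm (\<mu> *\<^sub>C H u - L (H u))"
      using resolvent_setD(2)[OF \<mu>, of "h u - H u"] resolvent_map_diff[of "h u" "H u" \<mu>] h H
      by (simp add: C_def norm_minus_commute)
    also have "\<dots> \<le> C * (cmod \<mu> * (c * norm u) + c * norm u)"
      using c C by (intro mult_left_mono order_trans[OF norm_triangle_ineq4] add_mono)
        (auto simp: norm_scaleC mult_left_mono)
    finally show ?thesis
      using c(1)[of u] norm_triangle_ineq[of "h u - H u" "H u"] by (simp add: b_def algebra_simps)
  qed
  show ?thesis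
  proof (rule bounded_linear_intro)
    have eqI: "?P (G x) = K x" if "x \<in> D" "\<mu> *\<^sub>C x - L x = 0" for x
      using transfer_function_eq[OF \<mu> that] .
    show "?P (u + v) = ?P u + ?P v" for u v
      using eqI[of "h u + h v"] resolvent_map_add[of "h u" "h v" \<mu>] h
      by (simp add: node_simps P)
    show "?P (r *\<^sub>R u) = r *\<^sub>R ?P u" for r u
    proof -
      have "\<mu> *\<^sub>C (r *\<^sub>R h u) - L (r *\<^sub>R h u) = 0"
        using clinear_on_scaleR[OF clinear_on_resolvent_map[OF clinear_L] h(1)] h(2) by simp
      then show ?thesis
        using eqI[of "r *\<^sub>R h u"] h by (simp add: node_simps P)
    qed
    show "norm (?P u) \<le> norm u * (k * (b + cmod \<mu> * b))" for u
    proof -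
      have "L (h u) = \<mu> *\<^sub>C h u"
        using h(2)[of u] by simp
      then have "norm (?P u) \<le> k * (norm (h u) + cmod \<mu> * norm (h u))"
        using k(2)[OF h(1)[of u]] by (simp add: P norm_scaleC)
      also have "\<dots> \<le> k * (b * norm u + cmod \<mu> * (b * norm u))"
        using hb k(1) by (intro mult_left_mono add_mono) auto
      finally show ?thesis
        by (simp add: algebra_simps)
    qed
  qed
qed

text \<open>Once a particular solution with G x0 = 0 is removed, the boundary condition reads (I +
  P) u = w - K x0. Positivity of P makes I + P coercive with constant 1.\<close>

lemma solve_scattering_problem:
  assumes \<mu>: "\<mu> \<in> resolvent_set (ker_on D G) L" "Re \<mu> \<ge> 0"
  obtains x where "x \<in> D" "\<mu> *\<^sub>C x - L x = y" "G x + K x = w"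
proof -
  let ?P = "transfer_function D G L K \<mu>"
  obtain x0 where x0: "x0 \<in> D" "\<mu> *\<^sub>C x0 - L x0 = y" "G x0 = 0"
    using solve_boundary_problem[OF \<mu>(1)] by blast
  have "\<exists>u. u + ?P u = w - K x0"
  proof (rule lax_milgram[of "\<lambda>u. u + ?P u" 1])
    show "bounded_linear (\<lambda>u. u + ?P u)"
      using transfer_function_bounded_linear[OF \<mu>(1)]
      by (intro bounded_linear_add bounded_linear_ident)
    fix u
    obtain h where h: "h \<in> D" "\<mu> *\<^sub>C h - L h = 0" "G h = u"
      using solve_boundary_problem[OF \<mu>(1)] by blast
    have "0 \<le> inner (?P u) u"
      using inner_GK_ge[OF h(1,2)] transfer_function_eq[OF \<mu>(1) h(1,2)] h(3) \<mu>(2)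
      by (simp add: inner_commute) (meson mult_nonneg_nonneg order_trans zero_le_power2)
    then show "1 * (norm u)\<^sup>2 \<le> inner (u + ?P u) u"
      by (simp add: inner_add_left power2_norm_eq_inner)
  qed simp
  then obtain u where u: "u + ?P u = w - K x0"
    by blast
  obtain h where h: "h \<in> D" "\<mu> *\<^sub>C h - L h = 0" "G h = u"
    using solve_boundary_problem[OF \<mu>(1)] by blast
  show ?thesis
  proof (rule that[of "x0 + h"])
    show "x0 + h \<in> D"
      using x0 h by (simp add: node_simps)
    show "\<mu> *\<^sub>C (x0 + h) - L (x0 + h) = y"
      using resolvent_map_add[OF x0(1) h(1)] x0 h by simp
    have "K h = ?P u"
      using transfer_function_eq[OF \<mu>(1) h(1,2)] h(3) by simp
    then show "G (x0 + h) + K (x0 + h) = w"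
      using x0 h u by (simp add: node_simps algebra_simps)
  qed
qed

lemma clinear_GK: "clinear_on D (\<lambda>x. G x + K x)"
  using clinear_G clinear_K by (auto simp: clinear_on_def scaleC_add_right)

text \<open>Here \<mu> is controlled only through the kernel of G + K. That G + K is onto U is
  independent of \<mu> and is read off from solvability at the point 1.\<close>

lemma solve_scattering_problem':
  assumes \<mu>: "\<mu> \<in> resolvent_set (ker_on D (\<lambda>x. G x + K x)) L"
  obtains x where "x \<in> D" "\<mu> *\<^sub>C x - L x = y" "G x + K x = w"
proof -
  have "\<exists>x\<in>D. G x + K x = u" for u
    using solve_scattering_problem[OF right_half_plane_resolvent[of 1]] by (metis one_complex.sel(1) zero_le_one zero_less_one)
  then show ?thesis
    using boundary_problem_surj[OF clinear_L clinear_GK _ \<mu>] that by blast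
qed

text \<open>
  The factor \<open>\<surd>M\<close> (rather than \<open>M\<close>) for the boundary data comes from splitting off the part \<open>h\<close> of \<open>x\<close>
  with \<open>(\<i> s - L) h = 0\<close> and testing passivity with \<open>h - \<tau> (\<i> s - A\<^sub>0)\<^sup>-\<^sup>1 h\<close>, \<open>\<tau> = 1 / (2 M)\<close>.
\<close>

lemma scattering_bound:
  fixes s :: real
  assumes \<mu>: "\<i> * of_real s \<in> resolvent_set (ker_on D (\<lambda>x. G x + K x)) L"
    and M: "onorm (resolvent (ker_on D (\<lambda>x. G x + K x)) L (\<i> * of_real s)) \<le> M" "M > 0"
    and x: "x \<in> D"
  shows "norm x \<le> M * norm ((\<i> * of_real s) *\<^sub>C x - L x) + sqrt M * norm (G x + K x)"
proof -
  define \<mu> where "\<mu> = \<i> * complex_of_real s"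
  have Re: "Re \<mu> = 0"
    by (simp add: \<mu>_def)
  have solve: "\<exists>z\<in>D. \<mu> *\<^sub>C z - L z = y \<and> G z + K z = 0 \<and> norm z \<le> M * norm y" for y
  proof -
    obtain z where z: "z \<in> ker_on D (\<lambda>x. G x + K x)" "\<mu> *\<^sub>C z - L z = y"
      using resolvent_setD(1)[OF \<mu>, of y] by (auto simp: \<mu>_def)
    have "norm z \<le> onorm (resolvent (ker_on D (\<lambda>x. G x + K x)) L \<mu>) * norm y"
      using resolvent_setD(2)[OF \<mu> z(1)] z(2) by (simp add: \<mu>_def)
    also have "\<dots> \<le> M * norm y"
      using M(1) by (intro mult_right_mono) (auto simp: \<mu>_def)
    finally show ?thesis
      using z by (auto simp: ker_on_def)
  qed
  define y where "y = \<mu> *\<^sub>C x - L x"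
  obtain x0 where x0: "x0 \<in> D" "\<mu> *\<^sub>C x0 - L x0 = y" "G x0 + K x0 = 0" "norm x0 \<le> M * norm y"
    using solve by blast
  define h where "h = x - x0"
  have h: "h \<in> D" "\<mu> *\<^sub>C h - L h = 0"
    using x x0 resolvent_map_diff[of x x0 \<mu>] by (auto simp: h_def y_def node_simps)
  have hGK: "G h + K h = G x + K x"
    using x x0 by (simp add: h_def node_simps algebra_simps)
  obtain r where r: "r \<in> D" "\<mu> *\<^sub>C r - L r = h" "G r + K r = 0" "norm r \<le> M * norm h"
    using solve by blast
  \<comment> \<open>Maximises \<tau> - \<tau>^2 M. The maximum 1 / (4 M) against the passivity bound
    |G x + K x|^2 / 4 yields exactly the factor sqrt M.\<close>
  define \<tau> where "\<tau> = 1 / (2 * M)"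
  have \<tau>: "\<tau> > 0"
    using M by (simp add: \<tau>_def)
  define z where "z = h - \<tau> *\<^sub>R r"
  have z: "z \<in> D"
    using h r by (simp add: z_def node_simps)
  have "\<mu> *\<^sub>C z - L z = (\<mu> *\<^sub>C h - L h) - \<tau> *\<^sub>R (\<mu> *\<^sub>C r - L r)"
    using h r unfolding z_def
    by (simp add: clinear_on_simps[OF clinear_L] node_simps scaleC_diff_right scaleC_scaleR algebra_simps)
  then have "L z = \<mu> *\<^sub>C z + \<tau> *\<^sub>R h"
    using h r by (simp add: algebra_simps)
  then have "inner (L z) z = \<tau> * (norm h)\<^sup>2 - \<tau>\<^sup>2 * inner h r"
    using Re by (simp add: inner_add_left inner_scaleC_self)
      (simp add: z_def inner_diff_right dot_square_norm power2_eq_square algebra_simps)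
  moreover have "inner h r \<le> M * (norm h)\<^sup>2"
    using norm_cauchy_schwarz[of h r] mult_left_mono[OF r(4), of "norm h"]
    by (simp add: power2_eq_square algebra_simps)
  then have "\<tau>\<^sup>2 * inner h r \<le> \<tau>\<^sup>2 * (M * (norm h)\<^sup>2)"
    by (rule mult_left_mono) simp
  moreover have "inner (L z) z \<le> (norm (G x + K x))\<^sup>2 / 4"
  proof -
    have "G z + K z = (G h + K h) - \<tau> *\<^sub>R (G r + K r)"
      using h(1) r(1) unfolding z_def by (simp add: node_simps algebra_simps)
    then have "G z + K z = G x + K x"
      using hGK r(3) by simp
    then show ?thesis
      using passive_inner[OF z] inner_le_norm_add[of "G z" "K z"] by simp
  qed
  moreover have "\<tau> * (norm h)\<^sup>2 - \<tau>\<^sup>2 * (M * (norm h)\<^sup>2) = (norm h)\<^sup>2 / (4 * M)"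
    using M by (simp add: \<tau>_def field_simps power2_eq_square)
  ultimately have "(norm h)\<^sup>2 / (4 * M) \<le> (norm (G x + K x))\<^sup>2 / 4"
    by linarith
  then have "(norm h)\<^sup>2 \<le> (sqrt M * norm (G x + K x))\<^sup>2"
    using M by (simp add: field_simps power_mult_distrib)
  then have "norm h \<le> sqrt M * norm (G x + K x)"
    using M by (intro power2_le_imp_le[of "norm h"]) auto
  moreover have "norm x \<le> norm x0 + norm h"
    using norm_triangle_ineq[of x0 h] by (simp add: h_def)
  ultimately show ?thesis
    using x0(4) unfolding y_def \<mu>_def by linarith
qed

text \<open>
  The transfer function is only controlled on \<open>Re \<mu> = 1\<close>. There the operator \<open>K (\<mu> - A)\<^sup>-\<^sup>1\<close> is
  bounded by testing passivity with boundary data \<open>u = - \<tau> K (\<mu> - A)\<^sup>-\<^sup>1 y\<close>, and all bounds are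
  then carried over to the imaginary axis by the resolvent identity.
\<close>

lemma imaginary_axis_bound:
  assumes res: "\<And>s::real. \<i> * of_real s \<in> resolvent_set (ker_on D G) L"
    and a: "\<And>s::real. onorm (resolvent (ker_on D G) L (\<i> * of_real s)) \<le> a"
    and B: "\<And>s::real. onorm (transfer_function D G L K (1 + \<i> * of_real s)) \<le> B"
  obtains N where "N > 0"
    "\<And>(s::real) x. x \<in> D \<Longrightarrow> norm x \<le> N * (norm ((\<i> * of_real s) *\<^sub>C x - L x) + norm (G x))"
    "\<And>(s::real) x. x \<in> D \<Longrightarrow> norm (K x) \<le> N * (norm ((\<i> * of_real s) *\<^sub>C x - L x) + norm (G x))"
proof -
  have rhp: "1 + \<i> * complex_of_real s \<in> resolvent_set (ker_on D G) L" for s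
    by (rule right_half_plane_resolvent) simp
  have B0: "B \<ge> 0"
    using onorm_pos_le[OF transfer_function_bounded_linear[OF rhp[of 0]]] B[of 0] by linarith
  have a0: "a \<ge> 0"
  proof -
    have "bounded_linear (resolvent (ker_on D G) L (\<i> * of_real 0))"
      using res[of 0] by (simp add: resolvent_set_def bounded_clinear_def)
    then show ?thesis
      using onorm_pos_le a[of 0] order_trans by blast
  qed
  \<comment> \<open>Enlarged so that b \<ge> 1: then b \<le> b^2, which keeps square roots out of
    the constants.\<close>
  define b where "b = B + 1"
  have b: "b \<ge> 1"
    using B0 by (simp add: b_def)
  have bb: "b \<le> b * b"
    using mult_left_mono[OF b, of b] b by simp
  \<comment> \<open>Read off from the last estimate of \<open>K x\<close>, where |K x| \<le> b ((a +
    1) b S + S) + b S with S = |y| + |G x|; it also dominates the factor (a + 1) b for |x|.\<close>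
  define N where "N = b * (2 + (a + 1) * b)"
  have main: "norm x \<le> N * (norm ((\<i> * of_real s) *\<^sub>C x - L x) + norm (G x)) \<and>
      norm (K x) \<le> N * (norm ((\<i> * of_real s) *\<^sub>C x - L x) + norm (G x))"
    if x: "x \<in> D" for x s
  proof -
    define \<mu> where "\<mu> = \<i> * complex_of_real s"
    define \<nu> where "\<nu> = 1 + \<mu>"
    have \<nu>: "\<nu> \<in> resolvent_set (ker_on D G) L" "Re \<nu> = 1"
      using rhp[of s] by (auto simp: \<nu>_def \<mu>_def)
    have hom: "norm (K h) \<le> B * norm (G h) \<and> norm h \<le> b * norm (G h)"
      if h: "h \<in> D" "\<nu> *\<^sub>C h - L h = 0" for h
    proof -
      have "norm (transfer_function D G L K \<nu> (G h)) \<le> onorm (transfer_function D G L K \<nu>) * norm (G h)"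
        by (rule onorm[OF transfer_function_bounded_linear[OF \<nu>(1)]])
      also have "\<dots> \<le> B * norm (G h)"
        using B[of s] by (intro mult_right_mono) (auto simp: \<nu>_def \<mu>_def)
      finally have Kh: "norm (K h) \<le> B * norm (G h)"
        by (simp add: transfer_function_eq[OF \<nu>(1) h])
      have "(norm h)\<^sup>2 \<le> norm (G h) * norm (K h)"
        using inner_GK_ge[OF h] norm_cauchy_schwarz[of "G h" "K h"] \<nu>(2) by simp
      also have "\<dots> \<le> norm (G h) * (b * norm (G h))"
        using Kh by (intro mult_left_mono) (simp_all add: b_def distrib_right add_increasing2)
      also have "\<dots> \<le> norm (G h) * ((b * b) * norm (G h))"
        using bb by (intro mult_left_mono mult_right_mono) auto
      also have "\<dots> = (b * norm (G h))\<^sup>2"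
        by (simp add: power2_eq_square)
      finally have "norm h \<le> b * norm (G h)"
        using b by (intro power2_le_imp_le[of "norm h"]) auto
      with Kh show ?thesis ..
    qed
    have KR: "norm (K z) \<le> b * norm (\<nu> *\<^sub>C z - L z)" if z: "z \<in> D" "G z = 0" for z
    proof -
      define y where "y = \<nu> *\<^sub>C z - L z"
      \<comment> \<open>With this \<tau> the cross term is at most half of \<tau> |K z|^2 and can be
        absorbed.\<close>
      define \<tau> where "\<tau> = 1 / (2 * b)"
      have \<tau>: "\<tau> > 0"
        using b by (simp add: \<tau>_def)
      obtain h where h: "h \<in> D" "\<nu> *\<^sub>C h - L h = 0" "G h = - (\<tau> *\<^sub>R K z)"
        using solve_boundary_problem[OF \<nu>(1)] by blast
      let ?w = "z + h"
      have w: "?w \<in> D" "\<nu> *\<^sub>C ?w - L ?w = y"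
        using z h resolvent_map_add[of z h \<nu>] by (auto simp: y_def node_simps)
      have Lw: "L ?w = \<nu> *\<^sub>C ?w - y"
        using w(2) by (simp add: algebra_simps)
      \<comment> \<open>Completing the square: Re \<nu> = 1 supplies |w|^2, which dominates the
        inner product with \<open>y\<close> up to |y|^2 / 4.\<close>
      have "0 \<le> (norm (?w - (1 / 2) *\<^sub>R y))\<^sup>2"
        by simp
      then have "- (norm y)\<^sup>2 / 4 \<le> (norm ?w)\<^sup>2 - inner y ?w"
        unfolding power2_norm_eq_inner
        by (simp add: inner_diff_left inner_diff_right inner_commute)
      also have "\<dots> = inner (L ?w) ?w"
        unfolding Lw inner_diff_left inner_scaleC_self using \<nu>(2) by simp
      also have "\<dots> \<le> inner (G ?w) (K ?w)"
        by (rule passive_inner[OF w(1)])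
      also have "\<dots> = - \<tau> * (norm (K z))\<^sup>2 - \<tau> * inner (K z) (K h)"
        using z h by (simp add: node_simps inner_add_right power2_norm_eq_inner algebra_simps)
      finally have 1: "\<tau> * (norm (K z))\<^sup>2 \<le> (norm y)\<^sup>2 / 4 - \<tau> * inner (K z) (K h)"
        by simp
      have "- inner (K z) (K h) \<le> norm (K z) * norm (K h)"
        using Cauchy_Schwarz_ineq2[of "K z" "K h"] by linarith
      also have "\<dots> \<le> norm (K z) * (b * (\<tau> * norm (K z)))"
      proof -
        have "norm (K h) \<le> B * (\<tau> * norm (K z))"
          using hom[OF h(1,2)] h(3) \<tau> by simp
        also have "\<dots> \<le> b * (\<tau> * norm (K z))"
          using \<tau> by (intro mult_right_mono) (auto simp: b_def)
        finally show ?thesis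
          by (intro mult_left_mono) auto
      qed
      also have "\<dots> = (norm (K z))\<^sup>2 / 2"
        using b by (simp add: \<tau>_def power2_eq_square)
      finally have "\<tau> * (- inner (K z) (K h)) \<le> \<tau> * ((norm (K z))\<^sup>2 / 2)"
        using \<tau> by (intro mult_left_mono) auto
      with 1 have "\<tau> * (norm (K z))\<^sup>2 \<le> (norm y)\<^sup>2 / 2"
        by simp
      then have "(norm (K z))\<^sup>2 \<le> b * (norm y)\<^sup>2"
        using b by (simp add: \<tau>_def field_simps)
      also have "\<dots> \<le> (b * b) * (norm y)\<^sup>2"
        using bb by (intro mult_right_mono) auto
      also have "\<dots> = (b * norm y)\<^sup>2"
        by (simp add: power2_eq_square)
      finally have "norm (K z) \<le> b * norm y"
        using b by (intro power2_le_imp_le[of "norm (K z)"]) auto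
      then show ?thesis
        by (simp add: y_def)
    qed
    define y where "y = \<mu> *\<^sub>C x - L x"
    \<comment> \<open>The boundary data are lifted at \<nu>, where the transfer function is bounded,
      rather than at \<mu>. The shift by 1 leaves only \<open>h\<close> as an extra source for z = x
      - h at \<mu>.\<close>
    obtain h where h: "h \<in> D" "\<nu> *\<^sub>C h - L h = 0" "G h = G x"
      using solve_boundary_problem[OF \<nu>(1)] by blast
    define z where "z = x - h"
    have z: "z \<in> D" "G z = 0"
      using x h by (auto simp: z_def node_simps)
    have \<nu>C: "\<nu> *\<^sub>C v = v + \<mu> *\<^sub>C v" for v :: 'x
      by (simp add: \<nu>_def scaleC_add_left)
    have "\<mu> *\<^sub>C h - L h = - h"
      using h(2) unfolding \<nu>C by (metis add_diff_eq add_eq_0_iff)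
    then have zh: "\<mu> *\<^sub>C z - L z = y + h"
      unfolding z_def resolvent_map_diff[OF x h(1)] y_def by simp
    have "\<nu> *\<^sub>C z - L z = z + (\<mu> *\<^sub>C z - L z)"
      by (simp add: \<nu>C add_diff_eq)
    then have \<nu>z: "\<nu> *\<^sub>C z - L z = x + y"
      unfolding zh by (simp add: z_def)
    have Kz: "norm (K z) \<le> b * (norm x + norm y)"
    proof -
      have "norm (K z) \<le> b * norm (x + y)"
        using KR[OF z] \<nu>z by simp
      also have "\<dots> \<le> b * (norm x + norm y)"
        using b by (intro mult_left_mono norm_triangle_ineq) simp
      finally show ?thesis .
    qed
    have "norm z \<le> onorm (resolvent (ker_on D G) L \<mu>) * norm (y + h)"
      using resolvent_setD(2)[OF res[of s], of z] z zh by (simp add: ker_on_def \<mu>_def)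
    also have "\<dots> \<le> a * (norm y + norm h)"
      using a[of s] a0 norm_triangle_ineq by (intro mult_mono) (auto simp: \<mu>_def)
    finally have zb: "norm z \<le> a * (norm y + norm h)" .
    have hb: "norm h \<le> b * norm (G x)" "norm (K h) \<le> b * norm (G x)"
    proof -
      show "norm h \<le> b * norm (G x)"
        using hom[OF h(1,2)] h(3) by simp
      have "B * norm (G x) \<le> b * norm (G x)"
        by (intro mult_right_mono) (auto simp: b_def)
      then show "norm (K h) \<le> b * norm (G x)"
        using hom[OF h(1,2)] h(3) by simp
    qed
    let ?S = "norm y + norm (G x)"
    have "norm y \<le> b * norm y"
      using mult_right_mono[OF b, of "norm y"] by simp
    then have yh: "norm y + norm h \<le> b * ?S"
      using hb(1) by (simp add: algebra_simps)
    have hS: "norm h \<le> b * ?S" "norm (K h) \<le> b * ?S" "norm y \<le> ?S" "norm x \<le> norm z + norm h"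
      "norm (K x) \<le> norm (K z) + norm (K h)"
    proof -
      show "norm h \<le> b * ?S"
        using yh by (meson add_increasing norm_ge_zero order_trans order_refl)
      have "b * norm (G x) \<le> b * ?S"
        using b by (intro mult_left_mono) auto
      then show "norm (K h) \<le> b * ?S"
        using hb(2) by linarith
      show "norm x \<le> norm z + norm h"
        using norm_triangle_ineq[of z h] by (simp add: z_def)
      have "K x = K z + K h"
        using x h(1) by (simp add: z_def node_simps)
      then show "norm (K x) \<le> norm (K z) + norm (K h)"
        by (simp add: norm_triangle_ineq)
    qed simp
    have "norm x \<le> a * (b * ?S) + b * ?S"
      using hS zb mult_left_mono[OF yh a0] by linarith
    then have xb: "norm x \<le> (a + 1) * b * ?S"
      by (simp add: algebra_simps)
    have "norm (K x) \<le> b * ((a + 1) * b * ?S + ?S) + b * ?S"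
      using hS Kz mult_left_mono[OF add_mono[OF xb hS(3)], of b] b by linarith
    then have "norm (K x) \<le> N * ?S"
      by (simp add: N_def algebra_simps)
    moreover have "(a + 1) * b * ?S \<le> N * ?S"
    proof (rule mult_right_mono)
      have "(a + 1) * b \<le> (a + 1) * (b * b)"
        using bb a0 by (intro mult_left_mono) auto
      then show "(a + 1) * b \<le> N"
        using b by (simp add: N_def algebra_simps)
    qed simp
    ultimately show ?thesis
      using xb unfolding y_def \<mu>_def by linarith
  qed
  have "N > 0"
    unfolding N_def using a0 b by (intro mult_pos_pos add_pos_nonneg) auto
  with main show ?thesis
    using that by blast
qed

end

section \<open>The coupled system\<close>

lemma solves_coupled_iff_solves_cauchy:
  "solves_coupled D1 G1 L1 K1 D2 G2 L2 K2 z1 z2 \<longleftrightarrow>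
    solves_cauchy (coupled_domain D1 G1 K1 D2 G2 K2) (coupled_operator L1 L2) (\<lambda>t. (z1 t, z2 t))"
proof -
  have "((\<lambda>t. (z1 t, z2 t)) has_vector_derivative (a, b)) (at t within {0..}) \<longleftrightarrow>
      (z1 has_vector_derivative a) (at t within {0..}) \<and> (z2 has_vector_derivative b) (at t within {0..})"
    for a b t
    using bounded_linear.has_vector_derivative[OF bounded_linear_fst,
        of "\<lambda>t. (z1 t, z2 t)" "(a, b)" "at t within {0..}"]
      bounded_linear.has_vector_derivative[OF bounded_linear_snd,
        of "\<lambda>t. (z1 t, z2 t)" "(a, b)" "at t within {0..}"]
    by (auto intro: has_vector_derivative_Pair)
  then show ?thesis
    by (auto simp: solves_coupled_def solves_cauchy_def coupled_domain_def coupled_operator_def)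
qed

section \<open>Scalar inequalities behind the rate\<close>

lemma quadratic_le:
  fixes k :: real
  assumes "e > 0" "v \<ge> 0" "c \<ge> 0" "e * k\<^sup>2 \<le> v * k + c"
  shows "k \<le> v / e + sqrt (c / e)"
proof (rule ccontr)
  define a b where "a = v / e" and "b = sqrt (c / e)"
  have ab: "a \<ge> 0" "b \<ge> 0" "v = e * a" "c = e * b\<^sup>2"
    using assms by (auto simp: a_def b_def)
  assume "\<not> ?thesis"
  then have k: "k > a + b"
    by (simp add: a_def b_def)
  have "e * k\<^sup>2 \<le> e * (a * k + b\<^sup>2)"
    using assms(4) ab by (simp add: algebra_simps)
  then have "k\<^sup>2 \<le> a * k + b\<^sup>2"
    using assms(1) by simp
  moreover have "(a + b) * k < k * k"
    using k ab by (intro mult_strict_right_mono) auto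
  moreover have "b * b \<le> b * k"
    using k ab by (intro mult_left_mono) auto
  ultimately show False
    by (simp add: power2_eq_square algebra_simps)
qed

text \<open>The scalar core. The variables stand for |x1|, k = |K1 x1|, V = |v| and Y = |y1| + |y2|,
  with M = M0(s) and e = \<eta>(s); N (Y + k) dominates |x2|. Choosing \<open>C\<close> before
  \<open>M\<close> and \<open>e\<close> makes it independent of \<open>s\<close>.\<close>

lemma coupled_estimate:
  fixes r N :: real
  assumes r: "r > 0" and N: "N > 0"
  shows "\<exists>C>0. \<forall>M e x k Y V. r \<le> M \<longrightarrow> 0 < e \<longrightarrow> e \<le> N \<longrightarrow>
    0 \<le> x \<longrightarrow> 0 \<le> Y \<longrightarrow> 0 \<le> V \<longrightarrow> V \<le> N * Y \<longrightarrow>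
    e * k\<^sup>2 \<le> V * k + Y * x \<longrightarrow> x \<le> M * Y + sqrt M * (V + (N + 1) * k) \<longrightarrow>
    x + N * (Y + k) \<le> C * (M / e) * Y"
proof -
  \<comment> \<open>\<open>C1\<close> collects the coefficients in the bound for \<open>x\<close>,
    doubled because half of \<open>x\<close> is absorbed; \<open>C\<close> adds those in the bound
    for N (Y + k).\<close>
  define C1 where "C1 = 2 * (N + N * N / sqrt r + (N + 1) * N / sqrt r + (N + 1)\<^sup>2 / 2)"
  define C where "C = C1 + N * (N / r + (N / r + (1 / r + C1) / 2))"
  have C1: "C1 > 0"
    unfolding C1_def using r N by (intro mult_pos_pos add_pos_nonneg) auto
  have "C > 0"
    unfolding C_def using C1 r N by (intro add_pos_nonneg) auto
  moreover have "x + N * (Y + k) \<le> C * (M / e) * Y"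
    if M: "r \<le> M" and e: "0 < e" "e \<le> N" and nonneg: "0 \<le> x" "0 \<le> Y" "0 \<le> V" and V: "V \<le> N * Y"
      and k: "e * k\<^sup>2 \<le> V * k + Y * x" and x: "x \<le> M * Y + sqrt M * (V + (N + 1) * k)"
    for M e x k Y V
  proof -
    define m where "m = M / e"
    have M0: "M > 0"
      using M r by simp
    have m: "m > 0" "M = e * m"
      using M0 e by (auto simp: m_def)
    have eM: "M \<le> N * m"
      unfolding m(2) using e m(1) by (intro mult_right_mono) auto
    have inv_e: "1 / e \<le> m / r"
      using M r e by (simp add: m_def field_simps)
    \<comment> \<open>Uses M \<ge> r together with e \<le> N; it lets terms without a factor M / e
      be charged to M / e.\<close>
    have one: "1 \<le> N / r * m"
      using M eM r by (simp add: field_simps)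
    have sqrtM: "sqrt M \<le> M / sqrt r"
    proof -
      have "sqrt M * sqrt r \<le> sqrt M * sqrt M"
        using M M0 by (intro mult_left_mono) auto
      then show ?thesis
        using r M0 by (simp add: field_simps)
    qed
    have k1: "k \<le> V / e + sqrt (Y * x / e)"
      using e k nonneg by (intro quadratic_le) auto
    have Ve: "V / e \<le> N / r * m * Y"
    proof -
      have "V / e = V * (1 / e)"
        by simp
      also have "\<dots> \<le> (N * Y) * (m / r)"
        using V inv_e nonneg e N by (intro mult_mono) auto
      finally show ?thesis
        by (simp add: field_simps)
    qed
    have Ye: "Y / e \<le> 1 / r * m * Y"
      using mult_left_mono[OF inv_e nonneg(2)] by (simp add: field_simps)
    \<comment> \<open>The decisive term: sqrt M and 1 / sqrt e combine under one root, and the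
      arithmetic-geometric mean inequality leaves x / 2 to be absorbed.\<close>
    have "sqrt M * ((N + 1) * sqrt (Y * x / e)) = sqrt (((N + 1)\<^sup>2 * m * Y) * x)"
      using N by (simp add: real_sqrt_mult real_sqrt_divide m_def)
    also have "\<dots> \<le> ((N + 1)\<^sup>2 * m * Y + x) / 2"
      using m nonneg by (intro arith_geo_mean_sqrt) auto
    finally have 1: "sqrt M * ((N + 1) * sqrt (Y * x / e)) \<le> ((N + 1)\<^sup>2 * m * Y + x) / 2" .
    have 2: "sqrt M * V \<le> (N * N / sqrt r) * m * Y"
    proof -
      have "sqrt M \<le> N * m / sqrt r"
        using sqrtM eM r by (meson divide_right_mono order_trans real_sqrt_ge_zero less_imp_le)
      then have "sqrt M * V \<le> (N * m / sqrt r) * (N * Y)"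
        using V nonneg m N r by (intro mult_mono) auto
      then show ?thesis
        by (simp add: field_simps)
    qed
    have 3: "sqrt M * ((N + 1) * (V / e)) \<le> ((N + 1) * N / sqrt r) * m * Y"
    proof -
      have "sqrt M * ((N + 1) * (V / e)) \<le> (M / sqrt r) * ((N + 1) * (N * Y / e))"
        using V sqrtM nonneg e N M0 r by (intro mult_mono divide_right_mono) auto
      then show ?thesis
        by (simp add: m_def field_simps)
    qed
    have 4: "M * Y \<le> N * m * Y"
      using eM nonneg by (intro mult_right_mono)
    have "sqrt M * ((N + 1) * k) \<le> sqrt M * ((N + 1) * (V / e + sqrt (Y * x / e)))"
      using k1 N M0 by (intro mult_left_mono) auto
    then have "x \<le> M * Y + sqrt M * V + sqrt M * ((N + 1) * (V / e)) + sqrt M * ((N + 1) * sqrt (Y * x / e))"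
      using x by (simp add: distrib_left)
    moreover have absorb: "x \<le> 2 * (A + B + C) + R"
      if "x \<le> a + b + c + d" "a \<le> A" "b \<le> B" "c \<le> C" "d \<le> (R + x) / 2" for a b c d A B C R :: real
    proof -
      have "2 * d \<le> R + x"
        using that(5) by simp
      then show ?thesis
        using that(1-4) by argo
    qed
    ultimately have "x \<le> 2 * (N * m * Y + (N * N / sqrt r) * m * Y + ((N + 1) * N / sqrt r) * m * Y)
        + (N + 1)\<^sup>2 * m * Y"
      using 1 2 3 4 by blast
    also have "\<dots> = C1 * m * Y"
      by (simp add: C1_def algebra_simps)
    finally have xb: "x \<le> C1 * m * Y" .
    have "sqrt (Y / e * x) \<le> (Y / e + x) / 2"
      using nonneg e by (intro arith_geo_mean_sqrt) auto
    then have sq: "sqrt (Y * x / e) \<le> (Y / e + x) / 2"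
      by simp
    have "k \<le> V / e + (Y / e + x) / 2"
      using k1 sq by (rule order_trans[OF _ add_left_mono])
    also have "\<dots> \<le> N / r * m * Y + (1 / r * m * Y + C1 * m * Y) / 2"
      using Ve Ye xb by (intro add_mono divide_right_mono) auto
    finally have "k \<le> N / r * m * Y + (1 / r * m * Y + C1 * m * Y) / 2" .
    then have "N * (Y + k) \<le> N * (N / r * m * Y + (N / r * m * Y + (1 / r * m * Y + C1 * m * Y) / 2))"
      using mult_right_mono[OF one nonneg(2)] N by (intro mult_left_mono add_mono) auto
    then have "x + N * (Y + k) \<le> C * m * Y"
      using xb by (simp add: C_def algebra_simps)
    then show ?thesis
      by (simp add: m_def)
  qed
  ultimately show ?thesis
    by blast
qed

locale coupled_nodes =
  n1: passive_node D1 G1 L1 K1 + n2: passive_node D2 G2 L2 K2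
  for D1 :: "'x1::chilbert_space set" and G1 :: "'x1 \<Rightarrow> 'u::chilbert_space" and L1 K1
    and D2 :: "'x2::chilbert_space set" and G2 :: "'x2 \<Rightarrow> 'u" and L2 K2
begin

abbreviation "CD \<equiv> coupled_domain D1 G1 K1 D2 G2 K2"
abbreviation "CA \<equiv> coupled_operator L1 L2"

lemma coupled_clinear: "clinear_on CD CA"
  unfolding clinear_on_def csubspace_def
  by (auto simp: coupled_domain_def coupled_operator_def scaleC_prod_def zero_prod_def
      n1.node_simps n2.node_simps clinear_on_simps[OF n1.clinear_L] clinear_on_simps[OF n2.clinear_L]
      clinear_on_0[OF n1.clinear_G] clinear_on_0[OF n1.clinear_K] clinear_on_0[OF n2.clinear_G] clinear_on_0[OF n2.clinear_K]
      scaleC_minus_right)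

text \<open>The coupling is power preserving: the supply rates of the two nodes cancel.\<close>

lemma coupled_dissipative:
  assumes "z \<in> CD"
  shows "inner (CA z) z \<le> 0"
proof -
  obtain x1 x2 where z: "z = (x1, x2)" "x1 \<in> D1" "x2 \<in> D2" "G1 x1 = K2 x2" "G2 x2 = - K1 x1"
    using assms by (auto simp: coupled_domain_def)
  have "inner (CA z) z = inner (L1 x1) x1 + inner (L2 x2) x2"
    by (simp add: z coupled_operator_def)
  also have "\<dots> \<le> inner (K2 x2) (K1 x1) + inner (- K1 x1) (K2 x2)"
    using n1.passive_inner[OF z(2)] n2.passive_inner[OF z(3)] z(4,5) by simp
  finally show ?thesis
    by (simp add: inner_commute)
qed

text \<open>
  In the scattering variables \<open>G + K\<close> and \<open>G - K\<close> the coupling is a feedback loop: at imaginary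
  frequencies the first node is contractive and, by coercivity of its transfer function, the second
  one is strictly contractive.
\<close>

lemma coupled_surj:
  fixes s :: real
  assumes res1: "\<i> * of_real s \<in> resolvent_set (ker_on D1 (\<lambda>x. G1 x + K1 x)) L1"
    and res2: "\<i> * of_real s \<in> resolvent_set (ker_on D2 G2) L2"
    and e: "e > 0"
    and coercive: "\<And>x. x \<in> D2 \<Longrightarrow> (\<i> * of_real s) *\<^sub>C x - L2 x = 0 \<Longrightarrow>
      e * (norm (G2 x))\<^sup>2 \<le> inner (K2 x) (G2 x)"
    and N: "N > 0"
    and bound: "\<And>x. x \<in> D2 \<Longrightarrow> (\<i> * of_real s) *\<^sub>C x - L2 x = 0 \<Longrightarrow> norm (K2 x) \<le> N * norm (G2 x)"
  shows "\<exists>z\<in>CD. (\<i> * of_real s) *\<^sub>C z - CA z = f"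
proof -
  define \<mu> where "\<mu> = \<i> * complex_of_real s"
  have Re: "Re \<mu> = 0"
    by (simp add: \<mu>_def)
  note res1 = res1[folded \<mu>_def] and res2 = res2[folded \<mu>_def]
    and coercive = coercive[folded \<mu>_def] and bound = bound[folded \<mu>_def]
  have "\<forall>w. \<exists>x. x \<in> D1 \<and> \<mu> *\<^sub>C x - L1 x = fst f \<and> G1 x + K1 x = w"
    by (intro allI) (rule n1.solve_scattering_problem'[OF res1], blast)
  then obtain f1 where f1: "\<And>w. f1 w \<in> D1" "\<And>w. \<mu> *\<^sub>C f1 w - L1 (f1 w) = fst f"
    "\<And>w. G1 (f1 w) + K1 (f1 w) = w"
    by metis
  have "\<forall>w. \<exists>x. x \<in> D2 \<and> \<mu> *\<^sub>C x - L2 x = snd f \<and> G2 x + K2 x = w"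
    by (intro allI) (rule n2.solve_scattering_problem[OF res2], auto simp: Re)
  then obtain f2 where f2: "\<And>w. f2 w \<in> D2" "\<And>w. \<mu> *\<^sub>C f2 w - L2 (f2 w) = snd f"
    "\<And>w. G2 (f2 w) + K2 (f2 w) = w"
    by metis
  \<comment> \<open>The signs are chosen so that the coupling becomes G2 x2 + K2 x2 = S1 w and w =
    S2 (S1 w) with w = G1 x1 + K1 x1. Both maps carry the source \<open>f\<close>, so only their
    differences solve homogeneous problems.\<close>
  define S1 where "S1 w = G1 (f1 w) - K1 (f1 w)" for w
  define S2 where "S2 w = K2 (f2 w) - G2 (f2 w)" for w
  have S1: "norm (S1 v - S1 w) \<le> norm (v - w)" for v w
  proof -
    let ?d = "f1 v - f1 w"
    have d: "?d \<in> D1" "\<mu> *\<^sub>C ?d - L1 ?d = 0"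
      using f1(1,2) n1.resolvent_map_diff[of "f1 v" "f1 w" \<mu>] by (simp_all add: n1.node_simps)
    have "G1 ?d + K1 ?d = (G1 (f1 v) + K1 (f1 v)) - (G1 (f1 w) + K1 (f1 w))"
      and Sd: "G1 ?d - K1 ?d = S1 v - S1 w"
      using f1(1) by (simp_all add: n1.node_simps S1_def)
    then have "G1 ?d + K1 ?d = v - w"
      by (simp only: f1(3))
    then have "(norm (S1 v - S1 w))\<^sup>2 \<le> (norm (v - w))\<^sup>2"
      using norm_diff_eq_norm_add[of "G1 ?d" "K1 ?d"] n1.inner_GK_ge[OF d] Re unfolding Sd by simp
    then show ?thesis
      by (rule power2_le_imp_le) simp
  qed
  \<comment> \<open>From |v - w| \<le> (1 + N) |G2 d| and the loss of 4 e |G2 d|^2 granted by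
    coercivity; \<open>max 0\<close> keeps the root nonnegative.\<close>
  define q where "q = sqrt (max 0 (1 - 4 * e / (1 + N)\<^sup>2))"
  have S2: "norm (S2 v - S2 w) \<le> q * norm (v - w)" for v w
  proof -
    let ?d = "f2 v - f2 w"
    have d: "?d \<in> D2" "\<mu> *\<^sub>C ?d - L2 ?d = 0"
      using f2(1,2) n2.resolvent_map_diff[of "f2 v" "f2 w" \<mu>] by (simp_all add: n2.node_simps)
    have "K2 ?d + G2 ?d = (G2 (f2 v) + K2 (f2 v)) - (G2 (f2 w) + K2 (f2 w))"
      and Sd: "K2 ?d - G2 ?d = S2 v - S2 w"
      using f2(1) by (simp_all add: n2.node_simps S2_def)
    then have vw: "K2 ?d + G2 ?d = v - w"
      by (simp only: f2(3))
    have "norm (v - w) \<le> (1 + N) * norm (G2 ?d)"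
      using norm_triangle_ineq[of "K2 ?d" "G2 ?d"] bound[OF d] unfolding vw by (simp add: algebra_simps)
    then have "(norm (v - w))\<^sup>2 \<le> ((1 + N) * norm (G2 ?d))\<^sup>2"
      by (rule power_mono) simp
    then have "4 * e / (1 + N)\<^sup>2 * (norm (v - w))\<^sup>2 \<le> 4 * e / (1 + N)\<^sup>2 * ((1 + N) * norm (G2 ?d))\<^sup>2"
      using e by (intro mult_left_mono) auto
    also have "\<dots> = 4 * (e * (norm (G2 ?d))\<^sup>2)"
      using N by (simp add: power_mult_distrib)
    also have "\<dots> \<le> 4 * inner (K2 ?d) (G2 ?d)"
      using coercive[OF d] by simp
    finally have "(norm (S2 v - S2 w))\<^sup>2 \<le> (1 - 4 * e / (1 + N)\<^sup>2) * (norm (v - w))\<^sup>2"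
      using norm_diff_eq_norm_add[of "K2 ?d" "G2 ?d"] unfolding Sd vw by (simp add: algebra_simps)
    also have "\<dots> \<le> (q * norm (v - w))\<^sup>2"
      by (simp add: q_def power_mult_distrib mult_right_mono)
    finally show ?thesis
      by (rule power2_le_imp_le) (simp add: q_def)
  qed
  have q: "0 \<le> q" "q < 1"
    using e N by (auto simp: q_def)
  have "\<exists>!w. S2 (S1 w) = w"
  proof (rule banach_fix_type[OF q], intro allI)
    fix v w
    have "norm (S2 (S1 v) - S2 (S1 w)) \<le> q * norm (v - w)"
      using S2[of "S1 v" "S1 w"] mult_left_mono[OF S1 q(1), of v w] by linarith
    then show "dist (S2 (S1 v)) (S2 (S1 w)) \<le> q * dist v w"
      by (simp add: dist_norm)
  qed
  then obtain w where w: "S2 (S1 w) = w"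
    by blast
  define x1 x2 where "x1 = f1 w" and "x2 = f2 (S1 w)"
  have x1: "x1 \<in> D1" "\<mu> *\<^sub>C x1 - L1 x1 = fst f" "G1 x1 + K1 x1 = w"
    and x2: "x2 \<in> D2" "\<mu> *\<^sub>C x2 - L2 x2 = snd f" "G2 x2 + K2 x2 = S1 w"
    using f1 f2 by (auto simp: x1_def x2_def)
  have z1: "G1 x1 - K1 x1 = G2 x2 + K2 x2"
    using x2(3) by (simp add: S1_def x1_def)
  have z2: "G1 x1 + K1 x1 = K2 x2 - G2 x2"
    using w x1(3) by (simp add: S2_def x2_def)
  have half: "a = b" if "2 *\<^sub>R a = 2 *\<^sub>R b" for a b :: 'u
    using that by simp
  have "(G1 x1 - K1 x1) + (G1 x1 + K1 x1) = (G2 x2 + K2 x2) + (K2 x2 - G2 x2)"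
    "(G1 x1 - K1 x1) - (G1 x1 + K1 x1) = (G2 x2 + K2 x2) - (K2 x2 - G2 x2)"
    by (simp_all only: z1 z2)
  moreover have "(a - b) + (a + b) = 2 *\<^sub>R a" "(a - b) - (a + b) = 2 *\<^sub>R (- b)"
    "(a + b) + (b - a) = 2 *\<^sub>R b" "(a + b) - (b - a) = 2 *\<^sub>R a" for a b :: 'u
    by (simp_all add: scaleR_2)
  ultimately have "G1 x1 = K2 x2" "- K1 x1 = G2 x2"
    by (metis half)+
  then have "G1 x1 = K2 x2" "G2 x2 = - K1 x1"
    by simp_all
  then have "(x1, x2) \<in> CD"
    using x1(1) x2(1) by (simp add: coupled_domain_def)
  moreover have "\<mu> *\<^sub>C (x1, x2) - CA (x1, x2) = f"
    using x1(2) x2(2) by (simp add: scaleC_prod_def coupled_operator_def prod_eq_iff)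
  ultimately show ?thesis
    unfolding \<mu>_def by blast
qed

text \<open>The analytic estimates are fed into a scalar implication, passed as hypothesis
  \<open>C\<close> for the given \<open>M\<close> and \<open>e\<close>. The 2 compares |y1| + |y2|
  with the product norm.\<close>

lemma coupled_bound:
  fixes s :: real
  assumes res1: "\<i> * of_real s \<in> resolvent_set (ker_on D1 (\<lambda>x. G1 x + K1 x)) L1"
    and M: "onorm (resolvent (ker_on D1 (\<lambda>x. G1 x + K1 x)) L1 (\<i> * of_real s)) \<le> M" "M > 0"
    and res2: "\<i> * of_real s \<in> resolvent_set (ker_on D2 G2) L2"
    and coercive: "\<And>x. x \<in> D2 \<Longrightarrow> (\<i> * of_real s) *\<^sub>C x - L2 x = 0 \<Longrightarrow>
      e * (norm (G2 x))\<^sup>2 \<le> inner (K2 x) (G2 x)"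
    and N: "N > 0"
    and N2: "\<And>x. x \<in> D2 \<Longrightarrow> norm x \<le> N * (norm ((\<i> * of_real s) *\<^sub>C x - L2 x) + norm (G2 x))"
    and NK: "\<And>x. x \<in> D2 \<Longrightarrow> norm (K2 x) \<le> N * (norm ((\<i> * of_real s) *\<^sub>C x - L2 x) + norm (G2 x))"
    and C: "\<And>x k Y V. 0 \<le> x \<Longrightarrow> 0 \<le> Y \<Longrightarrow> 0 \<le> V \<Longrightarrow> V \<le> N * Y \<Longrightarrow>
      e * k\<^sup>2 \<le> V * k + Y * x \<Longrightarrow> x \<le> M * Y + sqrt M * (V + (N + 1) * k) \<Longrightarrow>
      x + N * (Y + k) \<le> C * Y"
    and z: "z \<in> CD"
  shows "norm z \<le> C * (2 * norm ((\<i> * of_real s) *\<^sub>C z - CA z))"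
proof -
  define \<mu> where "\<mu> = \<i> * complex_of_real s"
  have Re: "Re \<mu> = 0"
    by (simp add: \<mu>_def)
  note res2 = res2[folded \<mu>_def] and coercive = coercive[folded \<mu>_def]
    and N2 = N2[folded \<mu>_def] and NK = NK[folded \<mu>_def]
  obtain x1 x2 where zx: "z = (x1, x2)" and x: "x1 \<in> D1" "x2 \<in> D2" "G1 x1 = K2 x2" "G2 x2 = - K1 x1"
    using z by (auto simp: coupled_domain_def)
  define y1 y2 where "y1 = \<mu> *\<^sub>C x1 - L1 x1" and "y2 = \<mu> *\<^sub>C x2 - L2 x2"
  define Y where "Y = norm y1 + norm y2"
  have f: "\<mu> *\<^sub>C z - CA z = (y1, y2)"
    by (simp add: zx y1_def y2_def scaleC_prod_def coupled_operator_def)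
  \<comment> \<open>Splits \<open>x2\<close> into the response \<open>h\<close> to its boundary
    data, to which coercivity applies, and a part driven by \<open>y2\<close> alone. Since G2 h = -
    K1 x1, this gives G1 x1 + P2 K1 x1 = v.\<close>
  obtain h where h: "h \<in> D2" "\<mu> *\<^sub>C h - L2 h = 0" "G2 h = G2 x2"
    using n2.solve_boundary_problem[OF res2] by blast
  define v where "v = K2 (x2 - h)"
  have "\<mu> *\<^sub>C (x2 - h) - L2 (x2 - h) = y2"
    using n2.resolvent_map_diff[OF x(2) h(1), of \<mu>] h(2) by (simp add: y2_def)
  moreover have "x2 - h \<in> D2" "G2 (x2 - h) = 0"
    using x h by (simp_all add: n2.node_simps)
  ultimately have "norm v \<le> N * norm y2"
    using NK[of "x2 - h"] by (simp add: v_def)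
  then have V: "norm v \<le> N * Y"
    using N by (simp add: Y_def algebra_simps add_increasing)
  have G1: "G1 x1 = v + K2 h"
    using x h by (simp add: v_def n2.node_simps)
  have k: "norm (G2 h) = norm (K1 x1)"
    using x h by simp
  have "- inner y1 x1 = inner (L1 x1) x1"
    using Re by (simp add: y1_def inner_diff_left inner_scaleC_self)
  also have "\<dots> \<le> inner (G1 x1) (K1 x1)"
    by (rule n1.passive_inner[OF x(1)])
  also have "\<dots> = inner v (K1 x1) - inner (K2 h) (G2 h)"
    using h(3) x(4) by (simp add: G1 inner_add_left)
  finally have "e * (norm (K1 x1))\<^sup>2 \<le> norm v * norm (K1 x1) + norm y1 * norm x1"
    using coercive[OF h(1,2)] norm_cauchy_schwarz[of v "K1 x1"] norm_cauchy_schwarz[of y1 x1]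
    unfolding k by linarith
  also have "\<dots> \<le> norm v * norm (K1 x1) + Y * norm x1"
    by (intro add_left_mono mult_right_mono) (auto simp: Y_def)
  finally have energy: "e * (norm (K1 x1))\<^sup>2 \<le> norm v * norm (K1 x1) + Y * norm x1" .
  have "norm (K2 h) \<le> N * norm (K1 x1)"
    using NK[OF h(1)] h(2) k by simp
  then have "norm (G1 x1 + K1 x1) \<le> norm v + (N + 1) * norm (K1 x1)"
    using norm_triangle_ineq[of "v + K2 h" "K1 x1"] norm_triangle_ineq[of v "K2 h"]
    unfolding G1 by (simp add: algebra_simps)
  then have "M * norm y1 + sqrt M * norm (G1 x1 + K1 x1) \<le> M * Y + sqrt M * (norm v + (N + 1) * norm (K1 x1))"
    using M(2) by (intro add_mono mult_left_mono) (auto simp: Y_def)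
  then have "norm x1 \<le> M * Y + sqrt M * (norm v + (N + 1) * norm (K1 x1))"
    using n1.scattering_bound[OF res1 M x(1)] by (simp add: y1_def \<mu>_def)
  then have main: "norm x1 + N * (Y + norm (K1 x1)) \<le> C * Y"
    using V energy by (intro C) (auto simp: Y_def)
  have "norm x2 \<le> N * (Y + norm (K1 x1))"
  proof -
    have "N * (norm y2 + norm (K1 x1)) \<le> N * (Y + norm (K1 x1))"
      using N by (intro mult_left_mono) (auto simp: Y_def)
    then show ?thesis
      using N2[OF x(2)] x(4) by (simp add: y2_def)
  qed
  then have zC: "norm z \<le> C * Y"
    using main norm_Pair_le[of x1 x2] by (simp add: zx)
  have "Y \<le> 2 * norm (y1, y2)"
    using norm_fst_le[of y1 y2] norm_snd_le[of y2 y1] by (simp add: Y_def)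
  moreover have "C \<ge> 0"
  proof -
    \<comment> \<open>The instance x = 0, Y = 1, V = 0, k = 0 reads N \<le> C.\<close>
    have "0 \<le> C * 1"
      using C[of 0 1 0 0] M(2) N by simp
    then show ?thesis by simp
  qed
  ultimately have "C * Y \<le> C * (2 * norm (y1, y2))"
    by (intro mult_left_mono)
  then show ?thesis
    using zC f by (simp add: \<mu>_def)
qed

text \<open>Surjectivity at \<open>0\<close> persists at small \<open>\<mu> > 0\<close>, and dissipativity propagates it to the half-line.\<close>

lemma coupled_m_dissipative:
  assumes surj: "\<And>f. \<exists>z\<in>CD. 0 *\<^sub>C z - CA z = f"
    and bound: "\<And>z. z \<in> CD \<Longrightarrow> norm z \<le> c * norm (0 *\<^sub>C z - CA z)"
  shows "m_dissipative CD CA"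
proof
  have bound': "norm z \<le> 1 / l * norm (of_real l *\<^sub>C z - CA z)" if "l > 0" "z \<in> CD" for l z
    using dissipative_bound[of CA z "of_real l", OF coupled_dissipative] that by (simp add: field_simps)
  \<comment> \<open>Small enough for one perturbation step away from 0; the absolute value is taken
    because \<open>c\<close> has no assumed sign.\<close>
  define l0 where "l0 = 1 / (2 * (\<bar>c\<bar> + 1))"
  have l0: "l0 > 0"
    by (simp add: l0_def add_nonneg_pos)
  have "l0 * c < 1"
    by (simp add: l0_def divide_simps add_nonneg_pos)
  then have base: "\<exists>z\<in>CD. of_real l0 *\<^sub>C z - CA z = f" for f
    using l0 by (intro resolvent_perturb[OF coupled_clinear surj bound]) auto
  \<comment> \<open>Dissipativity bounds the inverse at \<open>l\<close> by 1 / l, so one step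
    reaches every point of (0, 2 l).\<close>
  have step: "\<exists>z\<in>CD. of_real l' *\<^sub>C z - CA z = f"
    if "l > 0" "\<And>f. \<exists>z\<in>CD. of_real l *\<^sub>C z - CA z = f" "0 < l'" "l' < 2 * l" for l l' f
  proof (rule resolvent_perturb[OF coupled_clinear that(2) bound'[OF that(1)]])
    have "\<bar>l - l'\<bar> < l"
      using that by linarith
    moreover have "cmod (of_real l - of_real l') = \<bar>l - l'\<bar>"
      by (metis norm_of_real of_real_diff)
    ultimately show "cmod (of_real l - of_real l') * (1 / l) < 1"
      using that(1) by simp
  qed
  \<comment> \<open>Any factor strictly between 1 and 2 would serve; after enough steps the target 1
    / h lies within reach of a last one.\<close>
  have grow: "\<exists>z\<in>CD. of_real ((3 / 2) ^ n * l0) *\<^sub>C z - CA z = f" for n f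
  proof (induction n arbitrary: f)
    case (Suc n)
    show ?case
      by (rule step[OF _ Suc]) (use l0 in auto)
  qed (use base in simp)
  fix h :: real and f assume h: "h > 0"
  obtain n where n: "1 / h / l0 < (3 / 2) ^ n"
    using real_arch_pow[of "3 / 2"] by auto
  have "\<exists>z\<in>CD. of_real (1 / h) *\<^sub>C z - CA z = (1 / h) *\<^sub>R f"
  proof (rule step[OF _ grow])
    show "1 / h < 2 * ((3 / 2) ^ n * l0)"
    proof -
      have "1 / h < (3 / 2) ^ n * l0"
        using n by (simp only: pos_divide_less_eq[OF l0])
      moreover have "0 < (3 / 2) ^ n * l0"
        using l0 by simp
      ultimately show ?thesis
        by linarith
    qed
  qed (use l0 h in auto)
  then obtain z where z: "z \<in> CD" "(1 / h) *\<^sub>R z - CA z = (1 / h) *\<^sub>R f"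
    unfolding scaleC_of_real by blast
  have "z - h *\<^sub>R CA z = h *\<^sub>R ((1 / h) *\<^sub>R z - CA z)"
    using h by (simp add: scaleR_diff_right)
  also have "\<dots> = f"
    unfolding z(2) using h by simp
  finally have "z - h *\<^sub>R CA z = f" .
  then show "\<exists>x\<in>CD. x - h *\<^sub>R CA x = f"
    using z by blast
qed (auto intro: coupled_clinear coupled_dissipative)

end

theorem theorem1p1:
  fixes D1 :: "'x1::chilbert_space set" and D2 :: "'x2::chilbert_space set"
    and L1 :: "'x1 \<Rightarrow> 'x1" and G1 K1 :: "'x1 \<Rightarrow> 'u::chilbert_space"
    and L2 :: "'x2 \<Rightarrow> 'x2" and G2 K2 :: "'x2 \<Rightarrow> 'u"
    and M0 \<eta> :: "real \<Rightarrow> real" and r :: real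
  assumes U_nonzero: "\<exists>u::'u. u \<noteq> 0"
    and node1: "boundary_node D1 G1 L1 K1" and passive1: "impedance_passive D1 G1 L1 K1"
    and node2: "boundary_node D2 G2 L2 K2" and passive2: "impedance_passive D2 G2 L2 K2"
    and iR_A0: "\<And>s::real. \<i> * of_real s \<in> resolvent_set (ker_on D1 (\<lambda>x. G1 x + K1 x)) L1"
    and iR_A2: "\<And>s::real. \<i> * of_real s \<in> resolvent_set (ker_on D2 G2) L2"
    and r_pos: "r > 0" and M0_ge: "\<And>s. M0 s \<ge> r"
    and A0_bound:
      "\<And>s. onorm (resolvent (ker_on D1 (\<lambda>x. G1 x + K1 x)) L1 (\<i> * of_real s)) \<le> M0 s"
    and \<eta>_pos: "\<And>s. \<eta> s > 0"
    and P2_coercive: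
      "\<And>s u. Re (cinner (transfer_function D2 G2 L2 K2 (\<i> * of_real s) u) u) \<ge> \<eta> s * (norm u)\<^sup>2"
    and A2_bound:
      "\<exists>B. \<forall>s::real. onorm (resolvent (ker_on D2 G2) L2 (\<i> * of_real s)) \<le> B"
    and P2_bound:
      "\<exists>B. \<forall>s::real. onorm (transfer_function D2 G2 L2 K2 (1 + \<i> * of_real s)) \<le> B"
  shows
    "(\<forall>z1 z2. solves_coupled D1 G1 L1 K1 D2 G2 L2 K2 z1 z2 \<longleftrightarrow>
        solves_cauchy (coupled_domain D1 G1 K1 D2 G2 K2) (coupled_operator L1 L2)
          (\<lambda>t. (z1 t, z2 t))) \<and>
     generates_contraction_semigroup (coupled_domain D1 G1 K1 D2 G2 K2) (coupled_operator L1 L2) \<and>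
     (\<forall>s::real. \<i> * of_real s \<in>
        resolvent_set (coupled_domain D1 G1 K1 D2 G2 K2) (coupled_operator L1 L2)) \<and>
     (\<exists>C>0. \<forall>s::real.
        onorm (resolvent (coupled_domain D1 G1 K1 D2 G2 K2) (coupled_operator L1 L2)
          (\<i> * of_real s)) \<le> C * (M0 s / \<eta> s))"
proof -
  interpret coupled_nodes D1 G1 L1 K1 D2 G2 L2 K2
    by unfold_locales fact+
  obtain a where a: "\<And>s::real. onorm (resolvent (ker_on D2 G2) L2 (\<i> * of_real s)) \<le> a"
    using A2_bound by blast
  obtain b where b: "\<And>s::real. onorm (transfer_function D2 G2 L2 K2 (1 + \<i> * of_real s)) \<le> b"
    using P2_bound by blast
  obtain N where N: "N > 0"
    "\<And>(s::real) x. x \<in> D2 \<Longrightarrow> norm x \<le> N * (norm ((\<i> * of_real s) *\<^sub>C x - L2 x) + norm (G2 x))"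
    "\<And>(s::real) x. x \<in> D2 \<Longrightarrow> norm (K2 x) \<le> N * (norm ((\<i> * of_real s) *\<^sub>C x - L2 x) + norm (G2 x))"
    using n2.imaginary_axis_bound[OF iR_A2 a b] by blast
  have coercive: "\<eta> s * (norm (G2 x))\<^sup>2 \<le> inner (K2 x) (G2 x)"
    if "x \<in> D2" "(\<i> * of_real s) *\<^sub>C x - L2 x = 0" for s x
    using P2_coercive[of s "G2 x"] n2.transfer_function_eq[OF iR_A2 that] by (simp add: Re_cinner)
  \<comment> \<open>Coercivity at a nonzero \<open>u\<close> against |K2 h| \<le> N |u| caps \<eta>.
    On U = {0} coercivity would impose no condition on \<eta>.\<close>
  have \<eta>N: "\<eta> s \<le> N" for s
  proof -
    obtain u :: 'u where u: "u \<noteq> 0"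
      using U_nonzero by blast
    obtain h where h: "h \<in> D2" "(\<i> * of_real s) *\<^sub>C h - L2 h = 0" "G2 h = u"
      using n2.solve_boundary_problem[OF iR_A2] by blast
    have "\<eta> s * (norm u)\<^sup>2 \<le> norm (K2 h) * norm u"
      using coercive[OF h(1,2)] norm_cauchy_schwarz[of "K2 h" u] h(3) by simp
    also have "\<dots> \<le> N * (norm u)\<^sup>2"
      using mult_right_mono[OF N(3)[OF h(1), of s], of "norm u"] h(2,3)
      by (simp add: power2_eq_square mult.assoc)
    finally show ?thesis
      using u by simp
  qed
  have M0_pos: "M0 s > 0" for s
    using M0_ge[of s] r_pos by simp
  obtain C where C: "C > 0" and est: "\<And>M e x k Y V. r \<le> M \<Longrightarrow> 0 < e \<Longrightarrow> e \<le> N \<Longrightarrow> 0 \<le> x \<Longrightarrow>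
      0 \<le> Y \<Longrightarrow> 0 \<le> V \<Longrightarrow> V \<le> N * Y \<Longrightarrow> e * k\<^sup>2 \<le> V * k + Y * x \<Longrightarrow>
      x \<le> M * Y + sqrt M * (V + (N + 1) * k) \<Longrightarrow> x + N * (Y + k) \<le> C * (M / e) * Y"
    using coupled_estimate[OF r_pos N(1)] by blast
  have surj: "\<exists>z\<in>CD. (\<i> * of_real s) *\<^sub>C z - CA z = f" for s f
  proof (rule coupled_surj[OF iR_A0 iR_A2 \<eta>_pos coercive N(1)])
    show "norm (K2 x) \<le> N * norm (G2 x)" if "x \<in> D2" "(\<i> * of_real s) *\<^sub>C x - L2 x = 0" for x
      using N(3)[OF that(1), of s] unfolding that(2) by simp
  qed
  have bound: "norm z \<le> 2 * C * (M0 s / \<eta> s) * norm ((\<i> * of_real s) *\<^sub>C z - CA z)"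
    if "z \<in> CD" for s z
    using coupled_bound[OF iR_A0 A0_bound M0_pos iR_A2 coercive N
        est[OF M0_ge \<eta>_pos \<eta>N] that] by (simp add: mult_ac)
  \<comment> \<open>Only the frequency s = 0 is needed for generation.\<close>
  have "m_dissipative CD CA"
    using coupled_m_dissipative[of "2 * C * (M0 0 / \<eta> 0)"] surj[of 0] bound[of _ 0] by simp
  then have "generates_contraction_semigroup CD CA"
    by (rule m_dissipative.generates)
  moreover have "\<i> * of_real s \<in> resolvent_set CD CA" for s
    by (rule resolvent_setI(1)[OF coupled_clinear surj bound])
  moreover have "onorm (resolvent CD CA (\<i> * of_real s)) \<le> 2 * C * (M0 s / \<eta> s)" for s
    by (rule resolvent_setI(2)[OF coupled_clinear surj bound])
      (use C M0_pos[of s] \<eta>_pos[of s] in simp_all)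
  ultimately show ?thesis
    using C solves_coupled_iff_solves_cauchy[of D1 G1 L1 K1 D2 G2 L2 K2]
    by (intro conjI exI[of _ "2 * C"] allI) simp_all
qed

end
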